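(* There is a universal constant $C>0$ such that the following holds. Let $\nu$ be an isotropic log-concave probability measure on $\mathbb{R}$, $n\in\mathbb{N}$, and let $f:\mathbb{R}^n\to\mathbb{R}$ be a polynomial of degree $d$, $f(x)=\sum_{|I|\le d}\alpha_Ix^I$. Let $M_d(f)=\max\{|\alpha_I|:|I|=d\}$. Then for every $t\in\mathbb{R}\setminus\{0\}$, \[\left|\int_{\mathbb{R}^n}e^{\mathrm{i}tf(x)}\,d\nu^{\otimes n}(x)\right|\le\frac{Cd}{(M_d(f)|t|)^{1/d}}.\]
   Context: Multi-index notation: $I\in\mathbb{N}^n$, $|I|=\sum_iI_i$, $x^I=\prod_ix_i^{I_i}$. Isotropic means centered with unit variance; log-concave means having a density $e^{-\varphi}$ with $\varphi$ convex. $\nu^{\otimes n}$ is the $n$-fold product measure. *)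

theory Defs
  imports "HOL-Probability.Probability"
begin

text \<open>A nonnegative function g on the reals is log-concave if g = exp(-phi) with
  phi convex and valued in (-infinity, +infinity]; equivalently
  g((1-l)x + l y) >= g(x)^(1-l) g(y)^l for all l in (0,1).\<close>
definition log_concave_fun :: "(real \<Rightarrow> real) \<Rightarrow> bool" where
  "log_concave_fun g \<longleftrightarrow> (\<forall>x. 0 \<le> g x) \<and>
     (\<forall>x y l. 0 < l \<and> l < 1 \<longrightarrow>
        g x powr (1 - l) * g y powr l \<le> g ((1 - l) * x + l * y))"

definition log_concave_measure :: "real measure \<Rightarrow> bool" where
  "log_concave_measure \<nu> \<longleftrightarrow> prob_space \<nu> \<and>
     (\<exists>g. g \<in> borel_measurable borel \<and> log_concave_fun g \<and>
          \<nu> = density lborel (\<lambda>x. ennreal (g x)))"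

definition isotropic :: "real measure \<Rightarrow> bool" where
  "isotropic \<nu> \<longleftrightarrow> integrable \<nu> (\<lambda>x. x) \<and> integrable \<nu> (\<lambda>x. x\<^sup>2) \<and>
     (\<integral>x. x \<partial>\<nu>) = 0 \<and> (\<integral>x. x\<^sup>2 \<partial>\<nu>) = 1"

definition multi_indices :: "nat \<Rightarrow> nat \<Rightarrow> (nat \<Rightarrow> nat) set" where
  "multi_indices n d = {I. (\<forall>i\<ge>n. I i = 0) \<and> sum I {..<n} \<le> d}"

definition poly_eval :: "nat \<Rightarrow> nat \<Rightarrow> ((nat \<Rightarrow> nat) \<Rightarrow> real) \<Rightarrow> (nat \<Rightarrow> real) \<Rightarrow> real" where
  "poly_eval n d \<alpha> x = (\<Sum>I\<in>multi_indices n d. \<alpha> I * (\<Prod>i<n. x i ^ I i))"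

definition top_coeff_max :: "nat \<Rightarrow> nat \<Rightarrow> ((nat \<Rightarrow> nat) \<Rightarrow> real) \<Rightarrow> real" where
  "top_coeff_max n d \<alpha> = Max {\<bar>\<alpha> I\<bar> | I. I \<in> multi_indices n d \<and> sum I {..<n} = d}"

end

theory Submission
  imports Defs "HOL-Computational_Algebra.Fundamental_Theorem_Algebra"
begin

text \<open>Let \<open>f_d\<close> be the homogeneous part of degree \<open>d\<close>. A mixed finite difference produces a direction \<open>v\<close> of
  \<open>l1\<close>-norm at most \<open>d\<close> with \<open>\<bar>f_d v\<bar> \<ge> M / 2 ^ d\<close>. On every line in direction \<open>v\<close> the phase is a univariate
  polynomial of degree \<open>d\<close> with leading coefficient \<open>t * f_d v\<close>, and a van der Corput argument bounds a
  primitive \<open>H\<close> of the integrand along these lines by \<open>O(1) / \<bar>t * f_d v\<bar> powr (1 / d)\<close>, with an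
  absolute constant: split the line at the critical points of the derivative of the phase and use that the set
  where this derivative is small has small measure. Finally, an isotropic log-concave density is unimodal
  and bounded by an absolute constant, so translating one coordinate by \<open>s\<close> costs \<open>O(\<bar>s\<bar>)\<close> in total
  variation, and \<open>H(x + s v) - H(x)\<close> has integral at most \<open>O(\<bar>s\<bar> d)\<close> times the bound on \<open>H\<close>. Dividing by
  \<open>s\<close> and letting \<open>s\<close> tend to \<open>0\<close> gives the claim.\<close>

subsection \<open>One-dimensional oscillatory integrals\<close>

lemma cis_poly_has_vector_derivative:
  "((\<lambda>x. cis (poly p x)) has_vector_derivative \<i> * of_real (poly (pderiv p) x) * cis (poly p x)) (at x)"
proof -
  have "((\<lambda>x. exp (\<i> * of_real (poly p x))) has_vector_derivative
          (\<i> * of_real (poly (pderiv p) x)) * exp (\<i> * of_real (poly p x))) (at x)"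
  proof (rule has_vector_derivative_eq_rhs[OF field_vector_diff_chain_at[where g = exp, unfolded o_def]])
    show "((\<lambda>x. \<i> * of_real (poly p x)) has_vector_derivative \<i> * of_real (poly (pderiv p) x)) (at x)"
      by (intro has_vector_derivative_mult_right has_vector_derivative_of_real)
         (simp add: has_real_derivative_iff_has_vector_derivative[symmetric])
    show "(exp has_field_derivative exp (\<i> * of_real (poly p x))) (at (\<i> * of_real (poly p x)))"
      by (rule DERIV_exp)
  qed simp
  then show ?thesis by (simp add: cis_conv_exp)
qed

text \<open>Integration by parts with \<open>1 / p'\<close>. The two boundary terms cost
  \<open>1 / \<mu>\<close> each. Since \<open>p''\<close> has one sign, \<open>1 / p'\<close> is
  monotone, so the remaining integral is at most its variation, again
  \<open>1 / \<mu>\<close>.\<close>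

lemma van_der_corput_pos:
  fixes p :: "real poly" and F :: "real \<Rightarrow> complex"
  assumes F: "\<And>x. (F has_vector_derivative cis (poly p x)) (at x)"
    and ab: "a \<le> b" and mu: "\<mu> > 0"
    and lower: "\<And>x. a \<le> x \<Longrightarrow> x \<le> b \<Longrightarrow> \<mu> \<le> poly (pderiv p) x"
    and mono: "(\<forall>x\<in>{a..b}. 0 \<le> poly (pderiv (pderiv p)) x) \<or> (\<forall>x\<in>{a..b}. poly (pderiv (pderiv p)) x \<le> 0)"
  shows "norm (F b - F a) \<le> 3 / \<mu>"
proof -
  let ?q = "poly (pderiv p)" and ?r = "poly (pderiv (pderiv p))"
  \<comment> \<open>The correction term is chosen so that its derivative cancels
    \<open>cis (poly p x)\<close>, which leaves only the term carrying
    \<open>p'' / p'^2\<close>.\<close>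
  define W where "W x = F x + \<i> * cis (poly p x) / of_real (?q x)" for x
  \<comment> \<open>With the sign \<open>\<sigma>\<close> of \<open>p''\<close>, the function
    \<open>- \<sigma> / p'\<close> is a primitive of the bound \<open>\<bar>p''\<bar> / p'^2\<close>
    on the derivative of \<open>W\<close>.\<close>
  obtain \<sigma> :: real where s: "\<bar>\<sigma>\<bar> = 1" "\<And>x. a \<le> x \<Longrightarrow> x \<le> b \<Longrightarrow> \<bar>?r x\<bar> = \<sigma> * ?r x"
  proof (cases "\<forall>x\<in>{a..b}. 0 \<le> ?r x")
    case True
    then show ?thesis by (intro that[of 1]) auto
  next
    case False
    then show ?thesis using mono by (intro that[of "-1"]) auto
  qed
  have q0: "?q x > 0" if "a \<le> x" "x \<le> b" for x
    using lower[OF that] mu by linarith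
  have inv: "inverse (?q x) \<le> 1 / \<mu>" if "a \<le> x" "x \<le> b" for x
    using lower[OF that] mu by (simp add: divide_inverse le_imp_inverse_le)
  have W': "(W has_vector_derivative - (\<i> * cis (poly p x) * of_real (?r x / (?q x)\<^sup>2))) (at x)"
    if "a \<le> x" "x \<le> b" for x
  proof -
    have "((\<lambda>x. inverse (?q x)) has_real_derivative - (?r x / (?q x)\<^sup>2)) (at x)"
      using q0[OF that] by (auto intro!: derivative_eq_intros simp: power2_eq_square divide_simps)
    then have "((\<lambda>x. of_real (inverse (?q x)) :: complex) has_vector_derivative of_real (- (?r x / (?q x)\<^sup>2))) (at x)"
      by (intro has_vector_derivative_of_real) (simp add: has_real_derivative_iff_has_vector_derivative)
    from has_vector_derivative_mult[OF cis_poly_has_vector_derivative[of p x] this]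
    have "((\<lambda>x. cis (poly p x) * of_real (inverse (?q x))) has_vector_derivative
       - (cis (poly p x) * of_real (?r x / (?q x)\<^sup>2)) + \<i> * cis (poly p x)) (at x)"
      using q0[OF that] by (simp add: field_simps)
    from has_vector_derivative_add[OF F has_vector_derivative_mult_right[OF this, of "\<i>"]]
    show ?thesis
      unfolding W_def by (simp add: field_simps)
  qed
  have phi: "((\<lambda>x. - \<sigma> * inverse (?q x)) has_vector_derivative \<bar>?r x\<bar> / (?q x)\<^sup>2) (at x)"
    if "a \<le> x" "x \<le> b" for x
    unfolding has_real_derivative_iff_has_vector_derivative[symmetric] s(2)[OF that]
    using q0[OF that] by (auto intro!: derivative_eq_intros simp: power2_eq_square divide_simps)
  have "norm (W b - W a) \<le> 1 / \<mu>"
  proof (cases "a = b")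
    case True
    then show ?thesis using mu by simp
  next
    case False
    with ab have "a < b" by simp
    have "norm (W b - W a) \<le> - \<sigma> * inverse (?q b) - - \<sigma> * inverse (?q a)"
    proof (rule differentiable_bound_general[OF \<open>a < b\<close>])
      show "continuous_on {a..b} W"
        using W' by (intro continuous_at_imp_continuous_on ballI) (auto intro: has_vector_derivative_continuous)
      show "continuous_on {a..b} (\<lambda>x. - \<sigma> * inverse (?q x))"
        using phi by (intro continuous_at_imp_continuous_on ballI has_vector_derivative_continuous) auto
      show "(W has_vector_derivative - (\<i> * cis (poly p x) * of_real (?r x / (?q x)\<^sup>2))) (at x)"
        if "a < x" "x < b" for x using W' that by simp
      show "((\<lambda>x. - \<sigma> * inverse (?q x)) has_vector_derivative \<bar>?r x\<bar> / (?q x)\<^sup>2) (at x)"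
        if "a < x" "x < b" for x using phi that by simp
      show "norm (- (\<i> * cis (poly p x) * of_real (?r x / (?q x)\<^sup>2))) \<le> \<bar>?r x\<bar> / (?q x)\<^sup>2"
        if "a < x" "x < b" for x by (simp add: norm_mult norm_divide norm_power)
    qed
    also have "\<dots> \<le> 1 / \<mu>"
    proof -
      have *: "- \<sigma> * u - - \<sigma> * w \<le> 1 / \<mu>" if "0 < u" "0 < w" "u \<le> 1 / \<mu>" "w \<le> 1 / \<mu>" for u w
      proof -
        have "\<sigma> = 1 \<or> \<sigma> = -1" using s(1) by linarith
        with that show ?thesis by auto
      qed
      show ?thesis using inv[of a] inv[of b] q0[of a] q0[of b] ab by (intro *) auto
    qed
    finally show ?thesis .
  qed
  moreover have "norm (\<i> * cis (poly p x) / of_real (?q x)) \<le> 1 / \<mu>" if "a \<le> x" "x \<le> b" for x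
    using inv[OF that] q0[OF that] by (simp add: norm_mult norm_divide norm_inverse divide_inverse)
  from this[of a] this[of b] ab
  have "norm (\<i> * cis (poly p a) / of_real (?q a)) \<le> 1 / \<mu>" "norm (\<i> * cis (poly p b) / of_real (?q b)) \<le> 1 / \<mu>" by auto
  moreover have "norm (F b - F a) \<le> norm (W b - W a) + (norm (\<i> * cis (poly p a) / of_real (?q a)) + norm (\<i> * cis (poly p b) / of_real (?q b)))"
  proof -
    have "F b - F a = (W b - W a) + (\<i> * cis (poly p a) / of_real (?q a) - \<i> * cis (poly p b) / of_real (?q b))"
      unfolding W_def by simp
    then show ?thesis
      by (metis norm_triangle_ineq norm_triangle_ineq4 add_left_mono order_trans)
  qed
  ultimately have "norm (F b - F a) \<le> 1 / \<mu> + (1 / \<mu> + 1 / \<mu>)"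
    by (meson add_mono order_trans)
  then show ?thesis by simp
qed

text \<open>A decreasing phase becomes an increasing one under complex conjugation of
  \<open>F\<close>.\<close>

lemma van_der_corput_monotone:
  fixes p :: "real poly" and F :: "real \<Rightarrow> complex"
  assumes F: "\<And>x. (F has_vector_derivative cis (poly p x)) (at x)"
    and ab: "a \<le> b" and mu: "\<mu> > 0"
    and lower: "(\<forall>x\<in>{a..b}. \<mu> \<le> poly (pderiv p) x) \<or> (\<forall>x\<in>{a..b}. poly (pderiv p) x \<le> - \<mu>)"
    and mono: "(\<forall>x\<in>{a..b}. 0 \<le> poly (pderiv (pderiv p)) x) \<or> (\<forall>x\<in>{a..b}. poly (pderiv (pderiv p)) x \<le> 0)"
  shows "norm (F b - F a) \<le> 3 / \<mu>"
  using lower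
proof
  assume "\<forall>x\<in>{a..b}. \<mu> \<le> poly (pderiv p) x"
  then show ?thesis using van_der_corput_pos[OF F ab mu _ mono] by auto
next
  assume A: "\<forall>x\<in>{a..b}. poly (pderiv p) x \<le> - \<mu>"
  have "((\<lambda>x. cnj (F x)) has_vector_derivative cis (poly (- p) x)) (at x)" for x
    using has_vector_derivative_cnj[OF F[of x]] by (simp add: cis_cnj)
  then have "norm (cnj (F b) - cnj (F a)) \<le> 3 / \<mu>"
    by (rule van_der_corput_pos[OF _ ab mu]) (use A mono in \<open>force simp: pderiv_minus\<close>)+
  then show ?thesis by (metis complex_cnj_diff complex_mod_cnj)
qed

text \<open>A strict sign change would force a root strictly inside. The closed interval matters
  because the endpoints of the cells used below may themselves be roots.\<close>

lemma poly_no_root_semidefinite: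
  fixes q :: "real poly"
  assumes "\<And>x. a < x \<Longrightarrow> x < b \<Longrightarrow> poly q x \<noteq> 0"
  shows "(\<forall>x\<in>{a..b}. 0 \<le> poly q x) \<or> (\<forall>x\<in>{a..b}. poly q x \<le> 0)"
proof (rule ccontr)
  assume "\<not> ?thesis"
  then obtain x y where xy: "x \<in> {a..b}" "y \<in> {a..b}" "poly q x < 0" "poly q y > 0"
    by (auto simp: not_le)
  then consider "x < y" | "y < x" by (metis less_asym not_less_iff_gr_or_eq)
  then show False
  proof cases
    case 1
    with xy poly_IVT_pos[of x y q] assms show False by force
  next
    case 2
    with xy poly_IVT_neg[of y x q] assms show False by force
  qed
qed

lemma poly_closed_sublevel: "closed {x::real. \<bar>poly q x\<bar> \<le> \<mu>}"
  by (intro closed_Collect_le continuous_intros)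

lemma norm_primitive_diff_le:
  fixes F :: "real \<Rightarrow> 'a::real_normed_vector"
  assumes F: "\<And>x. (F has_vector_derivative f x) (at x)" and f: "\<And>x. norm (f x) \<le> 1" and ab: "a \<le> b"
  shows "norm (F b - F a) \<le> b - a"
proof (cases "a = b")
  case False
  with ab have "a < b" by simp
  then have "norm (F b - F a) \<le> id b - id a"
  proof (rule differentiable_bound_general)
    show "continuous_on {a..b} F"
      using F by (intro continuous_at_imp_continuous_on ballI has_vector_derivative_continuous)
    show "(F has_vector_derivative f x) (at x)" for x by (rule F)
    show "(id has_vector_derivative 1) (at x)" for x :: real by (simp add: id_def)
    show "norm (f x) \<le> 1" for x by (rule f)
  qed simp
  then show ?thesis by simp
qed simp

text \<open>The points of \<open>S\<close> cut the interval into cells on which \<open>p'\<close> is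
  monotone and does not cross the levels \<open>\<mu>\<close> and \<open>- \<mu>\<close>. A cell
  with \<open>\<bar>p'\<bar> \<ge> \<mu>\<close> costs \<open>3 / \<mu>\<close>; any other cell lies
  in the sublevel set and costs its length. Half-open intervals keep the measure additive over
  cells.\<close>

lemma van_der_corput_split:
  fixes p :: "real poly" and F :: "real \<Rightarrow> complex"
  assumes F: "\<And>x. (F has_vector_derivative cis (poly p x)) (at x)"
    and mu: "\<mu> > 0" and S: "finite S"
    and roots: "\<And>x. poly (pderiv (pderiv p)) x = 0 \<or> \<bar>poly (pderiv p) x\<bar> = \<mu> \<Longrightarrow> x \<in> S"
    and ab: "a \<le> b"
  shows "norm (F b - F a) \<le> measure lborel ({x. \<bar>poly (pderiv p) x\<bar> \<le> \<mu>} \<inter> {a..<b})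
           + 3 / \<mu> * (real (card (S \<inter> {a<..<b})) + 1)"
  using ab
proof (induction "card (S \<inter> {a<..<b})" arbitrary: a b rule: less_induct)
  case less
  let ?E = "{x. \<bar>poly (pderiv p) x\<bar> \<le> \<mu>}"
  have E: "?E \<in> sets borel" by (intro borel_closed poly_closed_sublevel)
  have fin: "emeasure lborel (?E \<inter> {c..<d}) < \<infinity>" for c d
    by (rule le_less_trans[OF emeasure_mono[of _ "{c..d}"]]) (auto simp: emeasure_lborel_Icc_eq)
  show ?case
  proof (cases "S \<inter> {a<..<b} = {}")
    case True
    have nz: "poly (pderiv (pderiv p)) x \<noteq> 0" "poly (pderiv p - [:\<mu>:]) x \<noteq> 0" "poly (pderiv p + [:\<mu>:]) x \<noteq> 0"
      if "a < x" "x < b" for x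
      using roots[of x] True that mu by (auto simp: abs_if)
    have sd: "(\<forall>x\<in>{a..b}. \<mu> \<le> poly (pderiv p) x) \<or> (\<forall>x\<in>{a..b}. poly (pderiv p) x \<le> \<mu>)"
       "(\<forall>x\<in>{a..b}. - \<mu> \<le> poly (pderiv p) x) \<or> (\<forall>x\<in>{a..b}. poly (pderiv p) x \<le> - \<mu>)"
      using poly_no_root_semidefinite[OF nz(2)] poly_no_root_semidefinite[OF nz(3)]
      by (auto simp: le_minus_iff minus_le_iff add.commute neg_le_iff_le real_0_le_add_iff real_add_le_0_iff)
    have mono: "(\<forall>x\<in>{a..b}. 0 \<le> poly (pderiv (pderiv p)) x) \<or> (\<forall>x\<in>{a..b}. poly (pderiv (pderiv p)) x \<le> 0)"
      by (rule poly_no_root_semidefinite[OF nz(1)])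
    have "3 / \<mu> \<ge> 0" using mu by simp
    show ?thesis
    proof (cases "(\<forall>x\<in>{a..b}. \<mu> \<le> poly (pderiv p) x) \<or> (\<forall>x\<in>{a..b}. poly (pderiv p) x \<le> - \<mu>)")
      case large: True
      from van_der_corput_monotone[OF F \<open>a \<le> b\<close> mu large mono] True
      show ?thesis by (simp add: add_increasing)
    next
      \<comment> \<open>Neither \<open>p' - \<mu>\<close> nor \<open>p' + \<mu>\<close> changes sign
        on the cell, so failing to be large forces \<open>\<bar>p'\<bar> \<le> \<mu>\<close>
        throughout.\<close>
      case False
      have "{a..b} \<subseteq> ?E"
      proof
        fix x assume x: "x \<in> {a..b}"
        have "poly (pderiv p) x \<le> \<mu>"
          using sd(1) False x by blast
        moreover have "- \<mu> \<le> poly (pderiv p) x"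
          using sd(2) False x by blast
        ultimately show "x \<in> ?E" by auto
      qed
      then have "{a..<b} \<subseteq> ?E" by (rule order_trans[rotated]) auto
      then have "?E \<inter> {a..<b} = {a..<b}" by (rule Int_absorb1)
      then have m: "measure lborel (?E \<inter> {a..<b}) = b - a" using \<open>a \<le> b\<close> by simp
      have "norm (F b - F a) \<le> b - a"
        by (rule norm_primitive_diff_le[OF F _ \<open>a \<le> b\<close>]) simp
      then show ?thesis using m \<open>3 / \<mu> \<ge> 0\<close> by (simp add: add_increasing2)
    qed
  next
    case False
    \<comment> \<open>Any cut point serves for the induction: removing \<open>c\<close> from the
      count pays for the second \<open>+ 1\<close>, as there is one more cell than there are cut
      points.\<close>
    then obtain c where c: "c \<in> S" "a < c" "c < b" by auto
    have "S \<inter> {a<..<b} = insert c (S \<inter> {a<..<c} \<union> S \<inter> {c<..<b})" using c by auto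
    moreover have "card (S \<inter> {a<..<c} \<union> S \<inter> {c<..<b}) = card (S \<inter> {a<..<c}) + card (S \<inter> {c<..<b})"
      using S by (intro card_Un_disjoint) auto
    moreover have "c \<notin> S \<inter> {a<..<c} \<union> S \<inter> {c<..<b}" by auto
    ultimately have card: "card (S \<inter> {a<..<b}) = card (S \<inter> {a<..<c}) + card (S \<inter> {c<..<b}) + 1"
      using S by simp
    have "?E \<inter> {a..<b} = (?E \<inter> {a..<c}) \<union> (?E \<inter> {c..<b})" using c by auto
    moreover have "measure lborel ((?E \<inter> {a..<c}) \<union> (?E \<inter> {c..<b})) = measure lborel (?E \<inter> {a..<c}) + measure lborel (?E \<inter> {c..<b})"
      using E fin by (intro measure_Union) (auto simp: less_top)
    ultimately have meas: "measure lborel (?E \<inter> {a..<b}) = measure lborel (?E \<inter> {a..<c}) + measure lborel (?E \<inter> {c..<b})"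
      by simp
    have "norm (F b - F a) \<le> norm (F c - F a) + norm (F b - F c)"
      using norm_triangle_ineq[of "F c - F a" "F b - F c"] by simp
    also have "norm (F c - F a) \<le> measure lborel (?E \<inter> {a..<c}) + 3 / \<mu> * (real (card (S \<inter> {a<..<c})) + 1)"
      by (rule less(1)) (use c card in auto)
    also have "norm (F b - F c) \<le> measure lborel (?E \<inter> {c..<b}) + 3 / \<mu> * (real (card (S \<inter> {c<..<b})) + 1)"
      by (rule less(1)) (use c card in auto)
    finally show ?thesis unfolding meas card by (simp add: ring_distribs)
  qed
qed

section \<open>Measure of sublevel sets of real polynomials\<close>

text \<open>Split at distance \<open>m\<close> from \<open>r\<close>. The near part is at most the
  integral over the two sides, \<open>2 * sqrt m\<close> each; on the far part the integrand is at
  most \<open>m powr (-1/2)\<close>, which contributes \<open>sqrt m\<close>.\<close>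

lemma nn_integral_inverse_sqrt_le:
  fixes E :: "real set"
  assumes E: "E \<in> sets borel" and m: "emeasure lborel E = ennreal m" "m > 0"
  shows "(\<integral>\<^sup>+x. ennreal (\<bar>x - r\<bar> powr (-1/2)) * indicator E x \<partial>lborel) \<le> ennreal (5 * sqrt m)"
proof -
  define f where "f u = ennreal (u powr (-1/2)) * indicator {0..m} u" for u :: real
  have f[measurable]: "f \<in> borel_measurable borel" unfolding f_def by measurable
  have "((\<lambda>x. x powr (-1/2)) has_integral (m powr (-1/2+1) / (-1/2+1))) {0..m}"
    using m by (intro has_integral_powr_from_0) auto
  then have "(\<integral>\<^sup>+u. f u \<partial>lborel) = ennreal (m powr (-1/2+1) / (-1/2+1))"
    unfolding f_def by (intro nn_integral_has_integral_lebesgue') auto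
  also have "m powr (-1/2+1) / (-1/2+1) = 2 * sqrt m" using m by (simp add: powr_half_sqrt)
  finally have If: "(\<integral>\<^sup>+u. f u \<partial>lborel) = ennreal (2 * sqrt m)" .
  have I1: "(\<integral>\<^sup>+x. f (x - r) \<partial>lborel) = ennreal (2 * sqrt m)"
    using nn_integral_real_affine[of f 1 "-r"] If by simp
  have I2: "(\<integral>\<^sup>+x. f (r - x) \<partial>lborel) = ennreal (2 * sqrt m)"
    using nn_integral_real_affine[of f "-1" "r"] If by simp
  have "(\<integral>\<^sup>+x. ennreal (\<bar>x - r\<bar> powr (-1/2)) * indicator E x \<partial>lborel)
     \<le> (\<integral>\<^sup>+x. (f (x - r) + f (r - x)) + ennreal (m powr (-1/2)) * indicator E x \<partial>lborel)"
  proof (rule nn_integral_mono)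
    fix x
    show "ennreal (\<bar>x - r\<bar> powr (-1/2)) * indicator E x \<le> (f (x - r) + f (r - x)) + ennreal (m powr (-1/2)) * indicator E x"
    proof (cases "\<bar>x - r\<bar> \<le> m")
      case True
      then have "ennreal (\<bar>x - r\<bar> powr (-1/2)) \<le> f (x - r) + f (r - x)"
        unfolding f_def by (cases "x \<le> r") (auto simp: abs_if add_increasing add_increasing2)
      then have "ennreal (\<bar>x - r\<bar> powr (-1/2)) * 1 \<le> (f (x - r) + f (r - x)) + ennreal (m powr (-1/2)) * indicator E x"
        by (metis add_increasing2 mult.right_neutral zero_le)
      then show ?thesis by (auto simp: indicator_def)
    next
      case False
      then have "\<bar>x - r\<bar> powr (-1/2) \<le> m powr (-1/2)"
        using m by (intro powr_mono2') auto
      then show ?thesis by (auto simp: indicator_def add_increasing)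
    qed
  qed
  also have "\<dots> = (ennreal (2 * sqrt m) + ennreal (2 * sqrt m)) + ennreal (m powr (-1/2)) * ennreal m"
    using E by (simp add: nn_integral_add nn_integral_cmult I1 I2 m(1))
  also have "ennreal (m powr (-1/2)) * ennreal m = ennreal (sqrt m)"
  proof -
    have "m powr (-1/2) * m = m powr (-1/2) * m powr 1" using m by simp
    also have "\<dots> = sqrt m" unfolding powr_add[symmetric] using m by (simp add: powr_half_sqrt)
    finally show ?thesis using m by (simp add: ennreal_mult[symmetric])
  qed
  also have "(ennreal (2 * sqrt m) + ennreal (2 * sqrt m)) + ennreal (sqrt m) = ennreal (5 * sqrt m)"
    using m by (simp add: ennreal_plus[symmetric] del: ennreal_plus)
  finally show ?thesis .
qed

text \<open>Factorization over the complex numbers, with the roots listed with multiplicity so that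
  products over roots become products over indices.\<close>

lemma real_poly_complex_roots:
  fixes q :: "real poly"
  assumes "q \<noteq> 0"
  obtains z :: "nat \<Rightarrow> complex"
    where "\<And>x. \<bar>poly q x\<bar> = \<bar>lead_coeff q\<bar> * (\<Prod>i<degree q. norm (of_real x - z i))"
proof -
  let ?Q = "map_poly complex_of_real q"
  have deg: "degree ?Q = degree q" by (simp add: degree_map_poly)
  have "?Q \<noteq> 0" using assms by (simp add: map_poly_eq_0_iff)
  from alg_closed_imp_factorization[OF this] obtain A
    where A: "size A = degree q" "?Q = smult (lead_coeff ?Q) (\<Prod>x\<in>#A. [:-x, 1:])" unfolding deg by auto
  obtain xs where xs: "mset xs = A" using ex_mset by blast
  have len: "length xs = degree q" using A(1) xs by auto
  have "\<bar>poly q x\<bar> = \<bar>lead_coeff q\<bar> * (\<Prod>i<degree q. norm (of_real x - xs ! i))" for x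
  proof -
    have "(\<Prod>x\<in>#A. [:-x, 1:]) = prod_list (map (\<lambda>x. [:-x, 1:]) xs)"
      by (simp add: xs[symmetric] prod_mset_prod_list flip: mset_map)
    also have "\<dots> = (\<Prod>i<degree q. [:- (xs ! i), 1:])"
      by (simp add: prod.list_conv_set_nth len atLeast0LessThan)
    finally have "poly ?Q (of_real x) = lead_coeff ?Q * (\<Prod>i<degree q. of_real x - xs ! i)"
      by (subst A(2)) (simp add: poly_prod)
    moreover have "poly ?Q (of_real x) = of_real (poly q x)"
      by (simp add: poly_altdef deg coeff_map_poly)
    ultimately have "norm (of_real (poly q x) :: complex) = norm (lead_coeff ?Q * (\<Prod>i<degree q. of_real x - xs ! i))"
      by simp
    then show ?thesis
      by (simp add: norm_mult prod_norm deg coeff_map_poly)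
  qed
  then show thesis by (rule that)
qed

text \<open>With \<open>w\<^sub>i = \<bar>x - Re z\<^sub>i\<bar>\<close> the distances to the projected roots, the bound \<open>\<Prod>w\<^sub>i \<le> \<nu>\<close>
  forces the arithmetic mean of the \<open>w\<^sub>i powr (-1/2)\<close> to be at least \<open>\<nu> powr (-1/(2k))\<close>.
  Integrating over the sublevel set \<open>E\<close>, of measure \<open>m\<close>, gives \<open>m \<le> 5 \<nu> powr (1/(2k)) sqrt m\<close>.\<close>
lemma poly_sublevel_measure:
  fixes q :: "real poly"
  assumes deg: "degree q = k" "k \<ge> 1" and mu: "\<mu> > 0"
  shows "measure lborel ({x. \<bar>poly q x\<bar> \<le> \<mu>} \<inter> {a..<b}) \<le> 25 * (\<mu> / \<bar>lead_coeff q\<bar>) powr (1 / real k)"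
proof -
  define E where "E = {x. \<bar>poly q x\<bar> \<le> \<mu>} \<inter> {a..<b}"
  define m where "m = measure lborel E"
  have q0: "q \<noteq> 0" using deg by auto
  obtain z :: "nat \<Rightarrow> complex" where z: "\<And>x. \<bar>poly q x\<bar> = \<bar>coeff q (degree q)\<bar> * (\<Prod>i<degree q. norm (of_real x - z i))"
    using real_poly_complex_roots[OF q0] by blast
  then have z: "\<bar>poly q x\<bar> = \<bar>lead_coeff q\<bar> * (\<Prod>i<k. norm (of_real x - z i))" for x
    by (simp add: deg(1))
  \<comment> \<open>Replacing a root by its real part only decreases its distance to a real point,
    so the product stays below \<open>\<nu>\<close>.\<close>
  define r where "r i = Re (z i)" for i
  define \<nu> where "\<nu> = \<mu> / \<bar>lead_coeff q\<bar>"
  have nu: "\<nu> > 0" using mu q0 by (simp add: \<nu>_def)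
  \<comment> \<open>Normalized so that \<open>l ^ k = \<nu> powr (1/2)\<close>; the numbers
    \<open>l * \<bar>x - r i\<bar> powr (-1/2)\<close> then have product at least \<open>1\<close>
    on \<open>E\<close>, off the projected roots.\<close>
  define l where "l = \<nu> powr (1 / (2 * real k))"
  have l: "l > 0" using nu by (simp add: l_def)
  have E[measurable]: "E \<in> sets borel"
    unfolding E_def by (intro sets.Int) (auto intro: borel_closed poly_closed_sublevel)
  have "emeasure lborel E < \<infinity>" unfolding E_def
    by (rule le_less_trans[OF emeasure_mono[of _ "{a..b}"]]) (auto simp: emeasure_lborel_Icc_eq)
  then have m: "emeasure lborel E = ennreal m"
    unfolding m_def by (simp add: emeasure_eq_ennreal_measure less_top)
  \<comment> \<open>The arithmetic-geometric mean inequality, proved through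
    \<open>y \<le> exp (y - 1)\<close> in each factor. The points \<open>r i\<close> are excluded
    because \<open>0 powr (-1/2)\<close> is \<open>0\<close>.\<close>
  have pt: "real k \<le> l * (\<Sum>i<k. \<bar>x - r i\<bar> powr (-1/2))" if x: "x \<in> E" "x \<notin> r ` {..<k}" for x
  proof -
    have w: "\<bar>x - r i\<bar> > 0" if "i < k" for i using x that by auto
    have "(\<Prod>i<k. \<bar>x - r i\<bar>) \<le> (\<Prod>i<k. norm (of_real x - z i))"
    proof (rule prod_mono)
      show "0 \<le> \<bar>x - r i\<bar> \<and> \<bar>x - r i\<bar> \<le> norm (of_real x - z i)" for i
        using abs_Re_le_cmod[of "of_real x - z i"] by (simp add: r_def)
    qed
    also have "\<dots> \<le> \<nu>"
      using z[of x] x q0 unfolding E_def \<nu>_def by (simp add: field_simps)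
    finally have "(\<Prod>i<k. \<bar>x - r i\<bar>) powr (-1/2) \<ge> \<nu> powr (-1/2)"
      using w by (intro powr_mono2') (auto intro: prod_pos)
    also have "(\<Prod>i<k. \<bar>x - r i\<bar>) powr (-1/2) = (\<Prod>i<k. \<bar>x - r i\<bar> powr (-1/2))"
      by (rule prod_powr_distrib)
    finally have ge: "\<nu> powr (-1/2) \<le> (\<Prod>i<k. \<bar>x - r i\<bar> powr (-1/2))" .
    have "l ^ k = \<nu> powr (1/2)"
      using nu deg by (simp add: l_def powr_power)
    then have "1 = l ^ k * \<nu> powr (-1/2)"
      using nu by (simp add: powr_add[symmetric])
    also have "\<dots> \<le> l ^ k * (\<Prod>i<k. \<bar>x - r i\<bar> powr (-1/2))"
      using ge l by (intro mult_left_mono) auto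
    also have "\<dots> = (\<Prod>i<k. l * \<bar>x - r i\<bar> powr (-1/2))"
      by (simp add: prod.distrib)
    also have "\<dots> \<le> (\<Prod>i<k. exp (l * \<bar>x - r i\<bar> powr (-1/2) - 1))"
    proof (rule prod_mono)
      show "0 \<le> l * \<bar>x - r i\<bar> powr (-1/2) \<and> l * \<bar>x - r i\<bar> powr (-1/2) \<le> exp (l * \<bar>x - r i\<bar> powr (-1/2) - 1)" for i
        using l exp_ge_add_one_self[of "l * \<bar>x - r i\<bar> powr (-1/2) - 1"] by simp
    qed
    also have "\<dots> = exp (l * (\<Sum>i<k. \<bar>x - r i\<bar> powr (-1/2)) - real k)"
      by (simp add: exp_sum[symmetric] sum_subtractf sum_distrib_left)
    finally show ?thesis by simp
  qed
  show ?thesis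
  proof (cases "m = 0")
    case True
    then show ?thesis using nu by (simp add: m_def[symmetric] E_def[symmetric])
  next
    case False
    then have m0: "m > 0" unfolding m_def using measure_nonneg[of lborel E] by linarith
    have "ennreal (real k) * ennreal m = (\<integral>\<^sup>+x. ennreal (real k) * indicator E x \<partial>lborel)"
      by (simp add: nn_integral_cmult m)
    also have "\<dots> \<le> (\<integral>\<^sup>+x. ennreal l * (\<Sum>i<k. ennreal (\<bar>x - r i\<bar> powr (-1/2)) * indicator E x) \<partial>lborel)"
    proof (rule nn_integral_mono_AE)
      have "AE x in lborel. x \<notin> r ` {..<k}"
        by (intro AE_not_in) (simp add: finite_imp_null_set_lborel)
      then show "AE x in lborel. ennreal (real k) * indicator E x \<le> ennreal l * (\<Sum>i<k. ennreal (\<bar>x - r i\<bar> powr (-1/2)) * indicator E x)"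
      proof eventually_elim
        case (elim x)
        have "ennreal (real k) \<le> ennreal l * (\<Sum>i<k. ennreal (\<bar>x - r i\<bar> powr (-1/2)))" if "x \<in> E"
          using pt[OF that elim] l by (simp add: sum_ennreal ennreal_mult[symmetric] sum_nonneg)
        then show ?case by (auto simp: indicator_def)
      qed
    qed
    also have "\<dots> = ennreal l * (\<Sum>i<k. \<integral>\<^sup>+x. ennreal (\<bar>x - r i\<bar> powr (-1/2)) * indicator E x \<partial>lborel)"
    proof (subst nn_integral_cmult)
      show "(\<lambda>x. \<Sum>i<k. ennreal (\<bar>x - r i\<bar> powr (-1/2)) * indicator E x) \<in> borel_measurable lborel"
        by measurable
    qed (subst nn_integral_sum, measurable)
    also have "\<dots> \<le> ennreal l * (\<Sum>i<k. ennreal (5 * sqrt m))"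
      by (intro mult_left_mono sum_mono nn_integral_inverse_sqrt_le E m m0) auto
    also have "\<dots> = ennreal (l * (real k * (5 * sqrt m)))"
      using l m0 by (simp add: sum_ennreal ennreal_mult ennreal_of_nat_eq_real_of_nat)
    finally have "ennreal (real k * m) \<le> ennreal (l * (real k * (5 * sqrt m)))"
      using m0 by (simp add: ennreal_mult)
    then have "real k * m \<le> real k * (5 * l * sqrt m)"
      using l m0 by (subst (asm) ennreal_le_iff) (auto simp: algebra_simps)
    then have "sqrt m * sqrt m \<le> 5 * l * sqrt m" using deg m0 by simp
    then have "sqrt m \<le> 5 * l" using m0 by (subst (asm) mult_le_cancel_right) auto
    then have "(sqrt m)\<^sup>2 \<le> (5 * l)\<^sup>2" using m0 by (intro power_mono) auto
    also have "(5 * l)\<^sup>2 = 25 * \<nu> powr (1 / real k)"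
      using nu by (simp add: l_def power_mult_distrib powr_power)
    finally show ?thesis using m0 by (simp add: m_def E_def \<nu>_def)
  qed
qed

text \<open>The constant is \<open>34 = 25 + 9\<close>: \<open>25\<close> from the sublevel set of
  \<open>p'\<close>, and \<open>9\<close> from at most \<open>3 * d\<close> cells costing
  \<open>3 / \<mu>\<close> each.\<close>

lemma polynomial_oscillatory_bound:
  fixes p :: "real poly" and F :: "real \<Rightarrow> complex"
  assumes F: "\<And>x. (F has_vector_derivative cis (poly p x)) (at x)"
    and deg: "degree p = d" "d \<ge> 1"
  shows "norm (F b - F a) \<le> 34 / \<bar>lead_coeff p\<bar> powr (1 / real d)"
proof -
  have le: "norm (F b - F a) \<le> 34 / \<bar>lead_coeff p\<bar> powr (1 / real d)" if ab: "a \<le> b" for a b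
  proof -
    define c where "c = \<bar>lead_coeff p\<bar>"
    have p0: "p \<noteq> 0" using deg by auto
    then have c: "c > 0" by (simp add: c_def)
    have lead': "\<bar>lead_coeff (pderiv p)\<bar> = real d * c"
      using deg by (simp add: degree_pderiv coeff_pderiv c_def abs_mult)
    show ?thesis
    \<comment> \<open>For \<open>d = 1\<close> the derivative is constant, so the sublevel estimate
      does not apply, but a single van der Corput step suffices.\<close>
    proof (cases "d = 1")
      case True
      then have "degree (pderiv p) = 0" using deg by (simp add: degree_pderiv)
      then obtain k where k: "pderiv p = [:k:]" by (rule degree_eq_zeroE)
      then have "\<bar>k\<bar> = c" using lead' True by simp
      then have "k = c \<or> k = - c" by linarith
      then have "norm (F b - F a) \<le> 3 / c"
        by (intro van_der_corput_monotone[OF F ab c]) (auto simp: k pderiv_pCons)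
      also have "\<dots> \<le> 34 / c" using c by (simp add: divide_right_mono)
      finally show ?thesis using True c by (simp add: c_def)
    next
      case False
      with deg have d2: "d \<ge> 2" by simp
      \<comment> \<open>This threshold balances both costs: the factor \<open>d\<close> cancels the
        \<open>d\<close> in the leading coefficient of \<open>p'\<close> as well as the number of
        cells, leaving multiples of \<open>c powr (- 1 / d)\<close>.\<close>
      define \<mu> where "\<mu> = real d * c powr (1 / real d)"
      have mu: "\<mu> > 0" using c d2 by (simp add: \<mu>_def)
      have d': "degree (pderiv p) = d - 1" using deg by (simp add: degree_pderiv)
      have d'': "degree (pderiv (pderiv p)) = d - 2" using d' by (simp add: degree_pderiv)
      have n1: "pderiv (pderiv p) \<noteq> 0" using d' d2 by (simp add: pderiv_eq_0_iff)
      have e: "degree (pderiv p - [:\<mu>:]) = d - 1" "degree (pderiv p + [:\<mu>:]) = d - 1"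
        using d' d2 by (simp_all add: degree_add_eq_left diff_conv_add_uminus del: add_uminus_conv_diff)
      then have n2: "pderiv p - [:\<mu>:] \<noteq> 0" "pderiv p + [:\<mu>:] \<noteq> 0" using d2 by auto
      define S where "S = {x. poly (pderiv (pderiv p)) x = 0} \<union> ({x. poly (pderiv p - [:\<mu>:]) x = 0} \<union> {x. poly (pderiv p + [:\<mu>:]) x = 0})"
      have fS: "finite S" unfolding S_def using poly_roots_finite n1 n2 by blast
      \<comment> \<open>At most \<open>d - 2\<close> roots of \<open>p''\<close>, and at most
        \<open>d - 1\<close> solutions for each of \<open>p' = \<mu>\<close> and
        \<open>p' = - \<mu>\<close>.\<close>
      have "card S \<le> (d - 2) + ((d - 1) + (d - 1))"
        unfolding S_def using card_poly_roots_bound[OF n1] card_poly_roots_bound[OF n2(1)] card_poly_roots_bound[OF n2(2)]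
        unfolding d'' e by (intro order_trans[OF card_Un_le] add_mono) auto
      moreover have "card (S \<inter> {a<..<b}) \<le> card S" using fS by (intro card_mono) auto
      ultimately have "card (S \<inter> {a<..<b}) + 1 \<le> 3 * d" using d2 by linarith
      then have "real (card (S \<inter> {a<..<b}) + 1) \<le> real (3 * d)" by (rule of_nat_mono)
      then have cardb: "real (card (S \<inter> {a<..<b})) + 1 \<le> 3 * real d" by simp
      have "norm (F b - F a) \<le> measure lborel ({x. \<bar>poly (pderiv p) x\<bar> \<le> \<mu>} \<inter> {a..<b})
           + 3 / \<mu> * (real (card (S \<inter> {a<..<b})) + 1)"
        by (rule van_der_corput_split[OF F mu fS _ ab]) (auto simp: S_def abs_if split: if_splits)
      also have "\<dots> \<le> 25 * (\<mu> / (real d * c)) powr (1 / real (d - 1)) + 3 / \<mu> * (3 * real d)"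
        using poly_sublevel_measure[OF d' _ mu] lead' cardb mu d2
        by (intro add_mono mult_left_mono) auto
      also have "(\<mu> / (real d * c)) powr (1 / real (d - 1)) = 1 / c powr (1 / real d)"
      proof -
        have "\<mu> / (real d * c) = c powr (1 / real d - 1)"
          using d2 c by (simp add: \<mu>_def powr_diff)
        moreover have "(1 / real d - 1) * (1 / real (d - 1)) = - (1 / real d)"
          using d2 by (simp add: of_nat_diff field_simps)
        ultimately show ?thesis using c by (simp add: powr_powr powr_minus_divide)
      qed
      also have "3 / \<mu> * (3 * real d) = 9 * (1 / c powr (1 / real d))"
        using d2 c by (simp add: \<mu>_def field_simps)
      finally show ?thesis by (simp add: c_def)
    qed
  qed
  show ?thesis using le[of a b] le[of b a] by (cases "a \<le> b") (auto simp: norm_minus_commute)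
qed

subsection \<open>Translations of log-concave product measures\<close>

text \<open>Recentring at \<open>a\<close> and reflecting with \<open>s = -1\<close> lets a
  one-sided tail estimate at the origin serve for both tails at any point.\<close>

lemma log_concave_fun_affine:
  assumes "log_concave_fun g"
  shows "log_concave_fun (\<lambda>u. g (a + s * u))"
proof -
  have "g (a + s * x) powr (1 - l) * g (a + s * y) powr l \<le> g (a + s * ((1 - l) * x + l * y))"
    if "0 < l" "l < 1" for x y l
  proof -
    have "(1 - l) * (a + s * x) + l * (a + s * y) = a + s * ((1 - l) * x + l * y)"
      by (simp add: algebra_simps)
    then show ?thesis using assms that unfolding log_concave_fun_def by metis
  qed
  then show ?thesis using assms unfolding log_concave_fun_def by blast
qed

text \<open>This is unimodality: superlevel sets are intervals. A weighted geometric mean is at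
  least the minimum.\<close>

lemma log_concave_fun_min_le:
  assumes g: "log_concave_fun g" and xyz: "x \<le> y" "y \<le> z"
  shows "min (g x) (g z) \<le> g y"
proof (cases "x = y \<or> y = z")
  case True
  then show ?thesis by auto
next
  case False
  define l where "l = (y - x) / (z - x)"
  have l: "0 < l" "l < 1" using False xyz by (auto simp: l_def field_simps)
  define m where "m = min (g x) (g z)"
  have pos: "0 \<le> g t" for t using g by (simp add: log_concave_fun_def)
  have m: "0 \<le> m" "m \<le> g x" "m \<le> g z" using pos by (auto simp: m_def)
  have "l * (z - x) = y - x" using False xyz by (simp add: l_def)
  then have y: "(1 - l) * x + l * z = y" by (simp add: algebra_simps)
  have "m = m powr (1 - l) * m powr l"
    using m(1) by (cases "m = 0") (simp_all add: powr_add[symmetric])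
  also have "\<dots> \<le> g x powr (1 - l) * g z powr l"
    using m l pos by (intro mult_mono powr_mono2) auto
  also have "\<dots> \<le> g y" using g l y unfolding log_concave_fun_def by metis
  finally show ?thesis by (simp add: m_def)
qed

text \<open>If \<open>h r\<close> were at least \<open>h 0 / exp 1\<close>, unimodality would give
  mass at least \<open>2\<close> on \<open>{0..r}\<close>. So \<open>ln h\<close> drops by more than
  \<open>1\<close> between \<open>0\<close> and \<open>r\<close>, and concavity continues this drop
  linearly beyond \<open>r\<close>.\<close>

lemma log_concave_fun_tail:
  assumes h: "log_concave_fun h" and mh: "h \<in> borel_measurable borel"
    and int: "(\<integral>\<^sup>+u. ennreal (h u) \<partial>lborel) \<le> 1"
    and G: "h 0 > 0" and r: "r = 2 * exp 1 / h 0" and u: "u \<ge> r"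
  shows "h u \<le> h 0 * exp (- u / r)"
proof -
  define G where "G = h 0"
  have G0: "G > 0" and r0: "r > 0" using assms by (auto simp: G_def)
  have pos: "0 \<le> h t" for t using h by (simp add: log_concave_fun_def)
  have hr: "h r < G / exp 1"
  proof (rule ccontr)
    assume "\<not> ?thesis"
    then have ge: "G / exp 1 \<le> h r" by simp
    have "G / exp 1 \<le> h t" if "0 \<le> t" "t \<le> r" for t
    proof -
      have "G / exp 1 \<le> G" using G0 by (simp add: divide_le_eq)
      then show ?thesis using log_concave_fun_min_le[OF h that] ge unfolding G_def by linarith
    qed
    then have "(\<integral>\<^sup>+u. ennreal (G / exp 1) * indicator {0..r} u \<partial>lborel) \<le> (\<integral>\<^sup>+u. ennreal (h u) \<partial>lborel)"
      by (intro nn_integral_mono) (auto simp: indicator_def intro: ennreal_leI)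
    also have "(\<integral>\<^sup>+u. ennreal (G / exp 1) * indicator {0..r} u \<partial>lborel) = ennreal (G / exp 1) * ennreal r"
      using r0 by (simp add: nn_integral_cmult_indicator)
    also have "\<dots> = ennreal 2"
      using G0 r0 by (subst ennreal_mult[symmetric]) (auto simp: r G_def)
    finally have "ennreal 2 \<le> 1" using int by (rule order_trans)
    then show False by simp
  qed
  show ?thesis
  proof (cases "u = r \<or> h u = 0")
    case True
    then show ?thesis using hr r0 G0 by (auto simp: G_def exp_minus field_simps)
  next
    case False
    \<comment> \<open>The weight that makes \<open>r\<close> the convex combination of
      \<open>0\<close> and \<open>u\<close>.\<close>
    define l where "l = r / u"
    have l: "0 < l" "l < 1" using False u r0 by (auto simp: l_def)
    have hu: "h u > 0" using False pos[of u] by linarith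
    have "G powr (1 - l) * h u powr l \<le> h ((1 - l) * 0 + l * u)"
      using h l unfolding log_concave_fun_def G_def by metis
    also have "(1 - l) * 0 + l * u = r" using u r0 by (simp add: l_def)
    finally have "G powr (1 - l) * h u powr l < G / exp 1" using hr by simp
    then have "ln (G powr (1 - l) * h u powr l) < ln (G / exp 1)"
      using G0 hu by (subst ln_less_cancel_iff) auto
    then have "(1 - l) * ln G + l * ln (h u) < ln G - 1"
      using G0 hu by (simp add: ln_mult ln_div ln_powr)
    then have "l * ln (h u) < l * (ln G - 1 / l)"
      using l by (simp add: algebra_simps)
    then have "ln (h u) < ln G - 1 / l" using l by simp
    also have "1 / l = u / r" by (simp add: l_def)
    also have "ln G - u / r = ln (G * exp (- u / r))" using G0 by (simp add: ln_mult)
    finally show ?thesis using G0 hu unfolding G_def by (subst (asm) ln_less_cancel_iff) auto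
  qed
qed

text \<open>Rescaling by \<open>r\<close> reduces this to the value \<open>2\<close> of the Gamma
  function at \<open>3\<close>.\<close>

lemma nn_integral_square_exp:
  assumes "r > 0"
  shows "(\<integral>\<^sup>+u. ennreal (u\<^sup>2 * exp (- u / r)) * indicator {0..} u \<partial>lborel) = ennreal (2 * r ^ 3)"
proof -
  have "(\<integral>\<^sup>+u. ennreal (u\<^sup>2 * exp (- u / r)) * indicator {0..} u \<partial>lborel)
     = ennreal \<bar>r\<bar> * (\<integral>\<^sup>+v. ennreal ((0 + r * v)\<^sup>2 * exp (- (0 + r * v) / r)) * indicator {0..} (0 + r * v) \<partial>lborel)"
    using assms by (intro nn_integral_real_affine) auto
  also have "\<dots> = ennreal r * (\<integral>\<^sup>+v. ennreal (r\<^sup>2) * (ennreal (v ^ 2 * exp (- v)) * indicator {0..} v) \<partial>lborel)"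
    using assms
    by (auto intro!: arg_cong[where f = "(*) (ennreal r)"] nn_integral_cong
         simp: indicator_def zero_le_mult_iff power_mult_distrib ennreal_mult[symmetric] mult.assoc)
  also have "\<dots> = ennreal r * (ennreal (r\<^sup>2) * ennreal 2)"
    by (subst nn_integral_cmult) (auto simp: nn_intergal_power_times_exp_Ici[of 2])
  also have "\<dots> = ennreal (2 * r ^ 3)"
    using assms by (simp add: ennreal_mult power3_eq_cube power2_eq_square mult_ac)
  finally show ?thesis .
qed

text \<open>Both tails of \<open>g\<close> around \<open>x0\<close> decay exponentially at scale \<open>1 / g x0\<close>, so a large value
  \<open>g x0\<close> would force the second moment about \<open>x0\<close> to be small.\<close>
lemma log_concave_density_le:
  assumes g: "log_concave_fun g" and mg[measurable]: "g \<in> borel_measurable borel"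
    and int: "(\<integral>\<^sup>+x. ennreal (g x) \<partial>lborel) \<le> 1"
    and second: "1 \<le> (\<integral>\<^sup>+x. ennreal ((x - x0)\<^sup>2 * g x) \<partial>lborel)"
  shows "g x0 \<le> 30"
proof (cases "g x0 = 0")
  case False
  have pos: "0 \<le> g t" for t using g by (simp add: log_concave_fun_def)
  define G where "G = g x0"
  have G: "G > 0" using False pos[of x0] by (simp add: G_def)
  define r where "r = 2 * exp 1 / G"
  have r: "r > 0" using G by (simp add: r_def)
  have tail: "g (x0 + s * u) \<le> G * exp (- u / r)" if s: "s = 1 \<or> s = -1" and u: "u \<ge> r" for s u
  proof -
    have "(\<integral>\<^sup>+u. ennreal (g (x0 + s * u)) \<partial>lborel) = (\<integral>\<^sup>+x. ennreal (g x) \<partial>lborel)"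
      using nn_integral_real_affine[of "\<lambda>x. ennreal (g x)" s x0] s by auto
    then show ?thesis
      using log_concave_fun_tail[OF log_concave_fun_affine[OF g, of x0 s], of r u] int G u
      by (simp add: G_def r_def)
  qed
  define e where "e u = ennreal (u\<^sup>2 * exp (- u / r)) * indicator {0..} u" for u
  have [measurable]: "e \<in> borel_measurable borel" unfolding e_def by measurable
  have "(\<integral>\<^sup>+x. ennreal ((x - x0)\<^sup>2 * g x) \<partial>lborel)
    \<le> (\<integral>\<^sup>+x. ennreal (r\<^sup>2) * ennreal (g x) + ennreal G * (e (x - x0) + e (x0 - x)) \<partial>lborel)"
  proof (rule nn_integral_mono)
    fix x
    show "ennreal ((x - x0)\<^sup>2 * g x) \<le> ennreal (r\<^sup>2) * ennreal (g x) + ennreal G * (e (x - x0) + e (x0 - x))"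
    proof (cases "\<bar>x - x0\<bar> \<le> r")
      case True
      then have "(x - x0)\<^sup>2 \<le> r\<^sup>2" using r by (simp add: abs_le_square_iff[symmetric])
      then have "ennreal ((x - x0)\<^sup>2 * g x) \<le> ennreal (r\<^sup>2) * ennreal (g x)"
        using pos by (simp add: ennreal_mult[symmetric] mult_right_mono ennreal_leI)
      then show ?thesis by (simp add: add_increasing2)
    next
      case False
      define u where "u = \<bar>x - x0\<bar>"
      have u: "u \<ge> r" "u > 0" using False r by (auto simp: u_def)
      have "g x \<le> G * exp (- u / r)"
        using tail[of 1 u] tail[of "-1" u] u by (auto simp: u_def abs_if split: if_splits)
      then have "(x - x0)\<^sup>2 * g x \<le> G * (u\<^sup>2 * exp (- u / r))"
        using mult_left_mono[of "g x" "G * exp (- u / r)" "u\<^sup>2"] by (simp add: u_def mult_ac)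
      then have "ennreal ((x - x0)\<^sup>2 * g x) \<le> ennreal G * e u"
        using G u by (simp add: e_def ennreal_mult[symmetric] ennreal_leI)
      also have "e u \<le> e (x - x0) + e (x0 - x)"
        by (auto simp: u_def abs_if add_increasing add_increasing2)
      finally show ?thesis by (meson add_increasing mult_left_mono order_trans zero_le)
    qed
  qed
  also have "\<dots> = ennreal (r\<^sup>2) * (\<integral>\<^sup>+x. ennreal (g x) \<partial>lborel) + ennreal G * ((\<integral>\<^sup>+x. e (x - x0) \<partial>lborel) + (\<integral>\<^sup>+x. e (x0 - x) \<partial>lborel))"
    by (simp add: nn_integral_add nn_integral_cmult)
  also have "(\<integral>\<^sup>+x. e (x - x0) \<partial>lborel) = ennreal (2 * r ^ 3)"
    using nn_integral_real_affine[of e 1 "-x0"] nn_integral_square_exp[OF r] by (simp add: e_def)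
  also have "(\<integral>\<^sup>+x. e (x0 - x) \<partial>lborel) = ennreal (2 * r ^ 3)"
    using nn_integral_real_affine[of e "-1" "x0"] nn_integral_square_exp[OF r] by (simp add: e_def)
  also have "ennreal (r\<^sup>2) * (\<integral>\<^sup>+x. ennreal (g x) \<partial>lborel) + ennreal G * (ennreal (2 * r ^ 3) + ennreal (2 * r ^ 3))
     \<le> ennreal (r\<^sup>2) * 1 + ennreal G * (ennreal (2 * r ^ 3) + ennreal (2 * r ^ 3))"
    using int by (intro add_mono mult_left_mono) auto
  also have "\<dots> = ennreal (r\<^sup>2 + G * (4 * r ^ 3))"
    using r G by (simp add: ennreal_mult[symmetric] ennreal_plus[symmetric] del: ennreal_plus)
  finally have "ennreal 1 \<le> ennreal (r\<^sup>2 + G * (4 * r ^ 3))"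
    unfolding ennreal_1 by (rule order_trans[OF second])
  then have "1 \<le> r\<^sup>2 + G * (4 * r ^ 3)" using r G by (subst (asm) ennreal_le_iff) auto
  \<comment> \<open>Substituting \<open>G = 2 * exp 1 / r\<close> and bounding \<open>exp 1\<close>
    by \<open>3\<close> gives \<open>1 \<le> 25 * r\<^sup>2\<close>. Hence
    \<open>r \<ge> 1 / 5\<close>, that is \<open>G \<le> 10 * exp 1 \<le> 30\<close>.\<close>
  also have "G * (4 * r ^ 3) = r\<^sup>2 * (8 * exp 1)"
    using G by (simp add: r_def power3_eq_cube power2_eq_square field_simps)
  also have "r\<^sup>2 + r\<^sup>2 * (8 * exp 1) \<le> r\<^sup>2 + r\<^sup>2 * (8 * 3)"
    using exp_le by (intro add_left_mono mult_left_mono) auto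
  finally have "1 \<le> (5 * r)\<^sup>2" by (simp add: power_mult_distrib)
  then have "1 \<le> 5 * r" using r by (metis abs_le_square_iff abs_of_pos abs_one one_power2 mult_pos_pos zero_less_numeral)
  then have "G \<le> 10 * exp 1" using G by (simp add: r_def field_simps)
  also have "\<dots> \<le> 30" using exp_le by simp
  finally show ?thesis by (simp add: G_def)
qed simp

section \<open>Total variation cost of translating a density\<close>

lemma emeasure_lborel_le_diameter:
  fixes A :: "real set"
  assumes diam: "\<And>x y. x \<in> A \<Longrightarrow> y \<in> A \<Longrightarrow> x < y \<Longrightarrow> y - x \<le> \<delta>" and d: "0 \<le> \<delta>"
  shows "emeasure lborel A \<le> ennreal \<delta>"
proof (cases "A = {}")
  case False
  then obtain z where z: "z \<in> A" by auto
  have diam': "y - x \<le> \<delta>" if "x \<in> A" "y \<in> A" for x y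
    using diam[OF that] d by (cases "x < y") auto
  have bdd: "bdd_below A" using diam'[OF _ z] by (intro bdd_belowI[of _ "z - \<delta>"]) (simp add: algebra_simps)
  have "A \<subseteq> {Inf A..Inf A + \<delta>}"
  proof
    fix y assume y: "y \<in> A"
    have "y - \<delta> \<le> Inf A" using False diam'[OF _ y] by (intro cInf_greatest) (auto simp: algebra_simps)
    with cInf_lower[OF y bdd] show "y \<in> {Inf A..Inf A + \<delta>}" by auto
  qed
  then have "emeasure lborel A \<le> emeasure lborel {Inf A..Inf A + \<delta>}" by (intro emeasure_mono) auto
  then show ?thesis using d by simp
qed simp

text \<open>By the layer cake formula it suffices to compare each superlevel set, an interval, with its translate.\<close>
lemma nn_integral_translation_diff_le:
  fixes g :: "real \<Rightarrow> real"
  assumes [measurable]: "g \<in> borel_measurable borel" and g: "\<And>x. 0 \<le> g x" "\<And>x. g x \<le> K"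
    and unimodal: "\<And>x y z. x \<le> y \<Longrightarrow> y \<le> z \<Longrightarrow> min (g x) (g z) \<le> g y"
  shows "(\<integral>\<^sup>+x. ennreal \<bar>g (x - s) - g x\<bar> \<partial>lborel) \<le> ennreal (2 * \<bar>s\<bar> * K)"
proof -
  have K: "0 \<le> K" using g[of 0] by linarith
  \<comment> \<open>The level \<open>t\<close> separates the two values; for fixed \<open>x\<close>
    the length of the set of such levels in \<open>{0..K}\<close> dominates the difference.\<close>
  define D where "D t x \<longleftrightarrow> (t < g (x - s)) \<noteq> (t < g x)" for t x
  have "(\<integral>\<^sup>+x. ennreal \<bar>g (x - s) - g x\<bar> \<partial>lborel)
     \<le> (\<integral>\<^sup>+x. \<integral>\<^sup>+t. indicator {0..K} t * indicator {x. D t x} x \<partial>lborel \<partial>lborel)"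
  proof (rule nn_integral_mono)
    fix x
    define a b where "a = min (g (x - s)) (g x)" and "b = max (g (x - s)) (g x)"
    have ab: "0 \<le> a" "a \<le> b" "b \<le> K" "\<bar>g (x - s) - g x\<bar> = b - a" using g by (auto simp: a_def b_def)
    have "ennreal \<bar>g (x - s) - g x\<bar> = emeasure lborel {a..<b}" using ab by simp
    also have "\<dots> = (\<integral>\<^sup>+t. indicator {a..<b} t \<partial>lborel)" by simp
    also have "\<dots> \<le> (\<integral>\<^sup>+t. indicator {0..K} t * indicator {x. D t x} x \<partial>lborel)"
      using ab(1,3) by (intro nn_integral_mono) (auto simp: indicator_def D_def a_def b_def)
    finally show "ennreal \<bar>g (x - s) - g x\<bar> \<le> (\<integral>\<^sup>+t. indicator {0..K} t * indicator {x. D t x} x \<partial>lborel)" .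
  qed
  also have "\<dots> = (\<integral>\<^sup>+t. \<integral>\<^sup>+x. indicator {0..K} t * indicator {x. D t x} x \<partial>lborel \<partial>lborel)"
    unfolding D_def indicator_def by (intro lborel_pair.Fubini') measurable
  also have "\<dots> \<le> (\<integral>\<^sup>+t. ennreal (2 * \<bar>s\<bar>) * indicator {0..K} t \<partial>lborel)"
  proof (rule nn_integral_mono)
    fix t
    \<comment> \<open>The two halves of the symmetric difference of a superlevel interval and its
      translate.\<close>
    define A B where "A = {x. t < g x \<and> \<not> t < g (x - s)}" and "B = {x. \<not> t < g x \<and> t < g (x - s)}"
    have [measurable]: "A \<in> sets borel" "B \<in> sets borel" unfolding A_def B_def by measurable
    have conv: "t < g y" if "x \<le> y" "y \<le> z" "t < g x" "t < g z" for x y z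
      using unimodal[OF that(1,2)] that(3,4) by auto
    \<comment> \<open>If the points were further apart than \<open>\<bar>s\<bar>\<close>, one of
      \<open>y - s\<close> and \<open>x - s\<close>, depending on the sign of \<open>s\<close>,
      would lie between them and hence in the superlevel interval, against membership in
      \<open>A\<close>.\<close>
    have "y - x \<le> \<bar>s\<bar>" if "x \<in> A" "y \<in> A" "x < y" for x y
    proof (rule ccontr)
      assume "\<not> ?thesis"
      then show False
        using that conv[of x "y - s" y] conv[of x "x - s" y] by (cases "s \<ge> 0") (auto simp: A_def)
    qed
    then have A: "emeasure lborel A \<le> ennreal \<bar>s\<bar>" by (rule emeasure_lborel_le_diameter) auto
    have "y - x \<le> \<bar>s\<bar>" if "x \<in> B" "y \<in> B" "x < y" for x y
    proof (rule ccontr)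
      assume "\<not> ?thesis"
      then show False
        using that conv[of "x - s" x "y - s"] conv[of "x - s" y "y - s"] by (cases "s \<ge> 0") (auto simp: B_def)
    qed
    then have B: "emeasure lborel B \<le> ennreal \<bar>s\<bar>" by (rule emeasure_lborel_le_diameter) auto
    have "{x. D t x} = A \<union> B" by (auto simp: D_def A_def B_def)
    then have "(\<integral>\<^sup>+x. indicator {0..K} t * indicator {x. D t x} x \<partial>lborel) = indicator {0..K} t * emeasure lborel (A \<union> B)"
      by (simp add: nn_integral_cmult_indicator)
    also have "\<dots> \<le> indicator {0..K} t * (ennreal \<bar>s\<bar> + ennreal \<bar>s\<bar>)"
      using A B by (intro mult_left_mono order_trans[OF emeasure_subadditive] add_mono) auto
    also have "\<dots> = ennreal (2 * \<bar>s\<bar>) * indicator {0..K} t"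
      by (simp add: ennreal_plus[symmetric] mult.commute del: ennreal_plus)
    finally show "(\<integral>\<^sup>+x. indicator {0..K} t * indicator {x. D t x} x \<partial>lborel) \<le> ennreal (2 * \<bar>s\<bar>) * indicator {0..K} t" .
  qed
  also have "\<dots> = ennreal (2 * \<bar>s\<bar> * K)"
    using K by (simp add: nn_integral_cmult_indicator ennreal_mult)
  finally show ?thesis .
qed

lemma norm_integral_le_integral:
  fixes f :: "'a \<Rightarrow> 'b::{banach, second_countable_topology}"
  assumes "integrable M f" "integrable M g" "\<And>x. x \<in> space M \<Longrightarrow> norm (f x) \<le> g x"
  shows "norm (\<integral>x. f x \<partial>M) \<le> (\<integral>x. g x \<partial>M)"
  by (rule order_trans[OF integral_norm_bound integral_mono]) (use assms in auto)

text \<open>A change of variables moves the translation from \<phi> to the density, where it costs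
  \<open>2 * \<bar>s\<bar> * 30\<close> in the L1 norm; hence the factor \<open>60\<close>.\<close>

lemma isotropic_log_concave_translation:
  fixes \<phi> :: "real \<Rightarrow> complex"
  assumes lc: "log_concave_measure \<nu>" and iso: "isotropic \<nu>"
    and [measurable]: "\<phi> \<in> borel_measurable borel" and bound: "\<And>x. norm (\<phi> x) \<le> B"
  shows "norm ((\<integral>x. \<phi> (x + s) \<partial>\<nu>) - (\<integral>x. \<phi> x \<partial>\<nu>)) \<le> 60 * \<bar>s\<bar> * B"
proof -
  from lc obtain g where prob: "prob_space \<nu>" and mg[measurable]: "g \<in> borel_measurable borel"
    and g: "log_concave_fun g" and \<nu>: "\<nu> = density lborel (\<lambda>x. ennreal (g x))"
    unfolding log_concave_measure_def by auto
  interpret prob_space \<nu> by (rule prob)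
  have pos: "0 \<le> g x" for x using g by (simp add: log_concave_fun_def)
  have B: "0 \<le> B" using bound[of 0] norm_ge_zero order_trans by blast
  have int1: "(\<integral>\<^sup>+x. ennreal (g x) \<partial>lborel) = 1"
    using emeasure_space_1 by (simp add: \<nu> emeasure_density)
  have le: "g x0 \<le> 30" for x0
  proof (rule log_concave_density_le[OF g mg])
    \<comment> \<open>By isotropy the second moment about any point is at least the variance
      \<open>1\<close>, as the density bound requires.\<close>
    have i: "integrable \<nu> (\<lambda>x. (x - x0)\<^sup>2)" "(\<integral>x. (x - x0)\<^sup>2 \<partial>\<nu>) = 1 + x0\<^sup>2"
      using iso unfolding isotropic_def power2_diff by (simp_all add: prob_space)
    have "(\<integral>\<^sup>+x. ennreal ((x - x0)\<^sup>2 * g x) \<partial>lborel) = (\<integral>\<^sup>+x. ennreal ((x - x0)\<^sup>2) \<partial>\<nu>)"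
      unfolding \<nu> by (subst nn_integral_density) (auto simp: ennreal_mult pos mult.commute)
    also have "\<dots> = ennreal (1 + x0\<^sup>2)"
      using i by (subst nn_integral_eq_integral) auto
    finally show "1 \<le> (\<integral>\<^sup>+x. ennreal ((x - x0)\<^sup>2 * g x) \<partial>lborel)" by simp
  qed (simp add: int1)
  have ig: "integrable lborel g"
    using int1 pos by (intro integrableI_nonneg) auto
  then have ig': "integrable lborel (\<lambda>x. g (x - s))"
    using lborel_integrable_real_affine[of g 1 "-s"] by simp
  have i\<phi>: "integrable lborel (\<lambda>x. h x *\<^sub>R \<phi> x)" if "integrable lborel h" for h :: "real \<Rightarrow> real"
  proof (rule Bochner_Integration.integrable_bound)
    show "integrable lborel (\<lambda>x. B * h x)" using that by simp
    show "(\<lambda>x. h x *\<^sub>R \<phi> x) \<in> borel_measurable lborel" using that by measurable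
    show "AE x in lborel. norm (h x *\<^sub>R \<phi> x) \<le> norm (B * h x)"
      using bound B by (intro AE_I2) (simp add: abs_mult mult.commute[of B] mult_left_mono)
  qed
  have "(\<integral>x. \<phi> (x + s) \<partial>\<nu>) = (\<integral>x. g x *\<^sub>R \<phi> (x + s) \<partial>lborel)"
    unfolding \<nu> by (subst integral_density) (auto simp: pos)
  also have "\<dots> = (\<integral>x. g (x - s) *\<^sub>R \<phi> x \<partial>lborel)"
    using lborel_integral_real_affine[of 1 "\<lambda>x. g x *\<^sub>R \<phi> (x + s)" "-s"] by simp
  finally have "(\<integral>x. \<phi> (x + s) \<partial>\<nu>) - (\<integral>x. \<phi> x \<partial>\<nu>) = (\<integral>x. g (x - s) *\<^sub>R \<phi> x - g x *\<^sub>R \<phi> x \<partial>lborel)"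
    using i\<phi>[OF ig] i\<phi>[OF ig'] unfolding \<nu> by (subst integral_density) (auto simp: pos)
  also have "norm \<dots> \<le> (\<integral>x. B * \<bar>g (x - s) - g x\<bar> \<partial>lborel)"
  proof (rule norm_integral_le_integral)
    show "norm (g (x - s) *\<^sub>R \<phi> x - g x *\<^sub>R \<phi> x) \<le> B * \<bar>g (x - s) - g x\<bar>" for x
      unfolding scaleR_left_diff_distrib[symmetric] using bound[of x] by (simp add: mult.commute mult_right_mono)
    show "integrable lborel (\<lambda>x. g (x - s) *\<^sub>R \<phi> x - g x *\<^sub>R \<phi> x)"
      using i\<phi>[OF ig] i\<phi>[OF ig'] by simp
    show "integrable lborel (\<lambda>x. B * \<bar>g (x - s) - g x\<bar>)" using ig ig' by simp
  qed
  also have "\<dots> \<le> B * (2 * \<bar>s\<bar> * 30)"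
  proof -
    have "ennreal (\<integral>x. \<bar>g (x - s) - g x\<bar> \<partial>lborel) = (\<integral>\<^sup>+x. ennreal \<bar>g (x - s) - g x\<bar> \<partial>lborel)"
      using ig ig' by (intro nn_integral_eq_integral[symmetric]) auto
    also have "\<dots> \<le> ennreal (2 * \<bar>s\<bar> * 30)"
      by (rule nn_integral_translation_diff_le[OF mg pos le log_concave_fun_min_le[OF g]])
    finally have "(\<integral>x. \<bar>g (x - s) - g x\<bar> \<partial>lborel) \<le> 2 * \<bar>s\<bar> * 30"
      by (subst (asm) ennreal_le_iff) auto
    then show ?thesis using B by (simp add: mult_left_mono)
  qed
  finally show ?thesis by (simp add: mult_ac)
qed

section \<open>Shifts of product measures\<close>

text \<open>By Fubini the coordinate \<open>k\<close> is integrated first. The one-dimensional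
  estimate holds on every fibre and survives averaging over the remaining coordinates.\<close>

lemma PiM_shift_coordinate:
  fixes \<Phi> :: "('i \<Rightarrow> real) \<Rightarrow> complex"
  assumes prob: "prob_space \<nu>" and sets: "sets \<nu> = sets borel"
    and shift: "\<And>\<phi> s B. \<phi> \<in> borel_measurable borel \<Longrightarrow> (\<And>x. norm (\<phi> x :: complex) \<le> B) \<Longrightarrow>
       norm ((\<integral>x. \<phi> (x + s) \<partial>\<nu>) - (\<integral>x. \<phi> x \<partial>\<nu>)) \<le> K * \<bar>s\<bar> * B"
    and I: "finite I" "k \<in> I"
    and m[measurable]: "\<Phi> \<in> borel_measurable (PiM I (\<lambda>_. \<nu>))" and bound: "\<And>x. norm (\<Phi> x) \<le> B"
  shows "norm ((\<integral>x. \<Phi> (x(k := x k + s)) \<partial>PiM I (\<lambda>_. \<nu>)) - (\<integral>x. \<Phi> x \<partial>PiM I (\<lambda>_. \<nu>))) \<le> K * \<bar>s\<bar> * B"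
proof -
  interpret prob_space \<nu> by (rule prob)
  interpret P: product_prob_space "\<lambda>_. \<nu>" I by unfold_locales
  define J where "J = I - {k}"
  have J: "finite J" "k \<notin> J" "I = insert k J" using I by (auto simp: J_def)
  interpret J: prob_space "PiM J (\<lambda>_. \<nu>)" by (intro prob_space_PiM prob)
  note [measurable_cong] = sets
  have add[measurable]: "(\<lambda>(f, y). f(k := y)) \<in> measurable (PiM J (\<lambda>_. \<nu>) \<Otimes>\<^sub>M \<nu>) (PiM I (\<lambda>_. \<nu>))"
    unfolding J(3) by (rule measurable_add_dim)
  have upd[measurable]: "(\<lambda>x. x(k := x k + s)) \<in> measurable (PiM I (\<lambda>_. \<nu>)) (PiM I (\<lambda>_. \<nu>))"
  proof (rule measurable_fun_upd)
    show "(\<lambda>x. x k + s) \<in> measurable (PiM I (\<lambda>_. \<nu>)) \<nu>"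
      unfolding measurable_cong_sets[OF refl sets] using I(2) by measurable
  qed (use I in auto)
  have integrable: "integrable (PiM I (\<lambda>_. \<nu>)) \<Psi>"
    if "\<Psi> \<in> borel_measurable (PiM I (\<lambda>_. \<nu>))" "\<And>x. norm (\<Psi> x) \<le> B" for \<Psi> :: "('i \<Rightarrow> real) \<Rightarrow> complex"
    using that by (intro P.P.integrable_const_bound[of _ B]) auto
  have insert_eq: "(\<integral>x. \<Psi> x \<partial>PiM I (\<lambda>_. \<nu>)) = (\<integral>x. (\<integral>y. \<Psi> (x(k := y)) \<partial>\<nu>) \<partial>PiM J (\<lambda>_. \<nu>))"
    if "\<Psi> \<in> borel_measurable (PiM I (\<lambda>_. \<nu>))" "\<And>x. norm (\<Psi> x) \<le> B" for \<Psi> :: "('i \<Rightarrow> real) \<Rightarrow> complex"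
    using P.product_integral_insert[OF J(1,2), of \<Psi>] integrable[OF that] J(3) by simp
  have meas_y: "(\<lambda>y. \<Phi> (x(k := y + c))) \<in> borel_measurable borel" if "x \<in> space (PiM J (\<lambda>_. \<nu>))" for x c
  proof -
    have "(\<lambda>y. x(k := y)) \<in> measurable \<nu> (PiM I (\<lambda>_. \<nu>))"
      unfolding J(3) by (rule measurable_component_update[OF that J(2)])
    from measurable_compose[OF this m] have "(\<lambda>y. \<Phi> (x(k := y))) \<in> borel_measurable borel"
      by (simp add: measurable_cong_sets[OF sets refl])
    from measurable_compose[OF _ this, of "\<lambda>y. y + c"] show ?thesis by simp
  qed
  have inner: "norm (\<integral>y. \<Phi> (x(k := y + c)) \<partial>\<nu>) \<le> B" if "x \<in> space (PiM J (\<lambda>_. \<nu>))" for x c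
  proof -
    have i: "integrable \<nu> (\<lambda>y. \<Phi> (x(k := y + c)))"
      using bound meas_y[OF that] by (intro integrable_const_bound[of _ B]) (auto simp: measurable_cong_sets[OF sets refl])
    have "norm (\<integral>y. \<Phi> (x(k := y + c)) \<partial>\<nu>) \<le> (\<integral>y. B \<partial>\<nu>)"
      using bound i by (intro norm_integral_le_integral) auto
    then show ?thesis by (simp add: prob_space)
  qed
  have int: "integrable (PiM J (\<lambda>_. \<nu>)) (\<lambda>x. \<integral>y. \<Phi> (x(k := y + c)) \<partial>\<nu>)" for c
  proof (rule J.integrable_const_bound[of _ B])
    have "(\<lambda>(x, y). \<Phi> (x(k := y + c))) = \<Phi> \<circ> (\<lambda>(f, y). f(k := y)) \<circ> (\<lambda>(x, y). (x, y + c))"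
      by (auto simp: fun_eq_iff)
    also have "\<dots> \<in> borel_measurable (PiM J (\<lambda>_. \<nu>) \<Otimes>\<^sub>M \<nu>)"
    proof (rule measurable_comp[OF _ measurable_comp[OF add m]])
      have "(\<lambda>z. snd z + c) \<in> measurable (PiM J (\<lambda>_. \<nu>) \<Otimes>\<^sub>M \<nu>) \<nu>"
        unfolding measurable_cong_sets[OF refl sets] by measurable
      then show "(\<lambda>(x, y). (x, y + c)) \<in> measurable (PiM J (\<lambda>_. \<nu>) \<Otimes>\<^sub>M \<nu>) (PiM J (\<lambda>_. \<nu>) \<Otimes>\<^sub>M \<nu>)"
        unfolding case_prod_beta' by (intro measurable_Pair measurable_fst)
    qed
    finally show "(\<lambda>x. \<integral>y. \<Phi> (x(k := y + c)) \<partial>\<nu>) \<in> borel_measurable (PiM J (\<lambda>_. \<nu>))"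
      by (intro borel_measurable_lebesgue_integral) (simp add: case_prod_beta')
  qed (use inner in \<open>auto intro: AE_I2\<close>)
  have e1: "(\<integral>x. \<Phi> (x(k := x k + s)) \<partial>PiM I (\<lambda>_. \<nu>)) = (\<integral>x. (\<integral>y. \<Phi> (x(k := y + s)) \<partial>\<nu>) \<partial>PiM J (\<lambda>_. \<nu>))"
    using insert_eq[OF measurable_compose[OF upd m] bound] by simp
  have e2: "(\<integral>x. \<Phi> x \<partial>PiM I (\<lambda>_. \<nu>)) = (\<integral>x. (\<integral>y. \<Phi> (x(k := y)) \<partial>\<nu>) \<partial>PiM J (\<lambda>_. \<nu>))"
    by (rule insert_eq[OF m bound])
  have "(\<integral>x. \<Phi> (x(k := x k + s)) \<partial>PiM I (\<lambda>_. \<nu>)) - (\<integral>x. \<Phi> x \<partial>PiM I (\<lambda>_. \<nu>))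
     = (\<integral>x. (\<integral>y. \<Phi> (x(k := y + s)) \<partial>\<nu>) - (\<integral>y. \<Phi> (x(k := y)) \<partial>\<nu>) \<partial>PiM J (\<lambda>_. \<nu>))"
    unfolding e1 e2 using int[of s] int[of 0] by (subst Bochner_Integration.integral_diff) simp_all
  also have "norm \<dots> \<le> (\<integral>x. K * \<bar>s\<bar> * B \<partial>PiM J (\<lambda>_. \<nu>))"
  proof (rule norm_integral_le_integral)
    show "integrable (PiM J (\<lambda>_. \<nu>)) (\<lambda>x. (\<integral>y. \<Phi> (x(k := y + s)) \<partial>\<nu>) - (\<integral>y. \<Phi> (x(k := y)) \<partial>\<nu>))"
      using int[of s] int[of 0] by simp
    fix x assume "x \<in> space (PiM J (\<lambda>_. \<nu>))"
    from meas_y[OF this, of 0] have "(\<lambda>y. \<Phi> (x(k := y))) \<in> borel_measurable borel" by simp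
    from shift[OF this bound] show "norm ((\<integral>y. \<Phi> (x(k := y + s)) \<partial>\<nu>) - (\<integral>y. \<Phi> (x(k := y)) \<partial>\<nu>)) \<le> K * \<bar>s\<bar> * B" .
  qed simp
  also have "\<dots> = K * \<bar>s\<bar> * B" by (simp add: J.prob_space)
  finally show ?thesis .
qed

text \<open>The coordinates are shifted one at a time and the costs add up. Each intermediate
  function \<open>\<Phi> (sh J x)\<close> is still bounded by \<open>B\<close>.\<close>

lemma PiM_shift:
  fixes \<Phi> :: "('i \<Rightarrow> real) \<Rightarrow> complex"
  assumes prob: "prob_space \<nu>" and sets: "sets \<nu> = sets borel"
    and shift: "\<And>\<phi> s B. \<phi> \<in> borel_measurable borel \<Longrightarrow> (\<And>x. norm (\<phi> x :: complex) \<le> B) \<Longrightarrow>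
       norm ((\<integral>x. \<phi> (x + s) \<partial>\<nu>) - (\<integral>x. \<phi> x \<partial>\<nu>)) \<le> K * \<bar>s\<bar> * B"
    and I: "finite I"
    and m[measurable]: "\<Phi> \<in> borel_measurable (PiM I (\<lambda>_. \<nu>))" and bound: "\<And>x. norm (\<Phi> x) \<le> B"
  shows "norm ((\<integral>x. \<Phi> (\<lambda>i\<in>I. x i + v i) \<partial>PiM I (\<lambda>_. \<nu>)) - (\<integral>x. \<Phi> x \<partial>PiM I (\<lambda>_. \<nu>))) \<le> K * (\<Sum>i\<in>I. \<bar>v i\<bar>) * B"
proof -
  let ?P = "PiM I (\<lambda>_. \<nu>)"
  note [measurable_cong] = sets
  define sh where "sh J x = (\<lambda>i\<in>I. if i \<in> J then x i + v i else x i)" for J and x :: "'i \<Rightarrow> real"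
  have sh_meas: "sh J \<in> measurable ?P ?P" for J
    unfolding sh_def
  proof (rule measurable_restrict)
    show "(\<lambda>x. if i \<in> J then x i + v i else x i) \<in> measurable ?P \<nu>" if "i \<in> I" for i
      unfolding measurable_cong_sets[OF refl sets] using that by measurable
  qed
  have "norm ((\<integral>x. \<Phi> (sh J x) \<partial>?P) - (\<integral>x. \<Phi> x \<partial>?P)) \<le> K * (\<Sum>i\<in>J. \<bar>v i\<bar>) * B"
    if "J \<subseteq> I" for J
    using finite_subset[OF that I] that
  proof (induction J rule: finite_induct)
    case empty
    have "(\<integral>x. \<Phi> (sh {} x) \<partial>?P) = (\<integral>x. \<Phi> x \<partial>?P)"
      by (intro Bochner_Integration.integral_cong) (auto simp: sh_def space_PiM PiE_def extensional_restrict cong: restrict_cong)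
    then show ?case by simp
  next
    case (insert k J)
    have "sh (insert k J) x = sh J (x(k := x k + v k))" for x
      using insert by (auto simp: sh_def fun_eq_iff)
    then have "norm ((\<integral>x. \<Phi> (sh (insert k J) x) \<partial>?P) - (\<integral>x. \<Phi> (sh J x) \<partial>?P)) \<le> K * \<bar>v k\<bar> * B"
      using PiM_shift_coordinate[OF prob sets shift I, of k "\<lambda>x. \<Phi> (sh J x)" B "v k"] insert bound
        measurable_compose[OF sh_meas m] by simp
    moreover have "norm ((\<integral>x. \<Phi> (sh J x) \<partial>?P) - (\<integral>x. \<Phi> x \<partial>?P)) \<le> K * (\<Sum>i\<in>J. \<bar>v i\<bar>) * B"
      using insert by auto
    moreover have "K * (\<Sum>i\<in>insert k J. \<bar>v i\<bar>) * B = K * \<bar>v k\<bar> * B + K * (\<Sum>i\<in>J. \<bar>v i\<bar>) * B"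
      using insert by (simp add: algebra_simps)
    ultimately show ?case by (simp only: norm_diff_triangle_le)
  qed
  from this[of I] show ?thesis by (simp add: sh_def cong: restrict_cong)
qed

subsection \<open>The top-degree form and restriction to lines\<close>

text \<open>The sum is the \<open>k\<close>-th finite difference of the \<open>j\<close>-th power at
  \<open>0\<close>. Up to the factor \<open>fact j\<close> it is the coefficient of order
  \<open>j\<close> of \<open>(exp X - 1) ^ k\<close>, a series that starts with
  \<open>X ^ k\<close>. For \<open>j = 0\<close> the convention \<open>0 ^ 0 = 1\<close> is in
  force.\<close>

lemma alternating_binomial_power_sum:
  fixes k j :: nat
  assumes "j \<le> k"
  shows "(\<Sum>m\<le>k. (-1) ^ (k - m) * real (k choose m) * real m ^ j) = (if j = k then fact k else 0)"
proof -
  define E where "E = (fps_exp 1 - 1 :: real fps)"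
  have "fps_nth E 0 = 0" by (simp add: E_def)
  then have E: "E = fps_X * fps_shift 1 E" by (intro fps_ext) auto
  have "E ^ k = (\<Sum>m\<le>k. of_nat (k choose m) * fps_exp (real m) * (- 1) ^ (k - m))"
    using binomial_ring[of "fps_exp 1" "-1 :: real fps" k] by (simp add: E_def fps_exp_power_mult)
  also have "fps_nth \<dots> j = (\<Sum>m\<le>k. (-1) ^ (k - m) * real (k choose m) * real m ^ j) / fact j"
  proof -
    have "fps_nth (of_nat (k choose m) * fps_exp (real m) * (- 1) ^ (k - m)) j = (-1) ^ (k - m) * real (k choose m) * real m ^ j / fact j" for m
    proof -
      have eq: "of_nat (k choose m) * fps_exp (real m) * (- 1) ^ (k - m) = fps_const ((-1) ^ (k - m) * real (k choose m)) * fps_exp (real m)"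
        by (simp add: fps_of_nat[symmetric] fps_const_power[symmetric] fps_const_neg[symmetric] mult_ac
              flip: fps_const_mult fps_const_1_eq_1 del: fps_const_power fps_const_neg)
      show ?thesis unfolding eq by simp
    qed
    then show ?thesis by (simp add: fps_sum_nth sum_divide_distrib)
  qed
  finally have 1: "fps_nth (E ^ k) j = (\<Sum>m\<le>k. (-1) ^ (k - m) * real (k choose m) * real m ^ j) / fact j" .
  have "fps_nth (E ^ k) j = (if j = k then 1 else 0)"
    using assms by (subst E) (simp add: power_mult_distrib fps_X_power_mult_nth fps_nth_power_0 E_def)
  with 1 show ?thesis by (auto split: if_splits)
qed

lemma finite_multi_indices: "finite (multi_indices n d)"
proof -
  have "multi_indices n d \<subseteq> (\<lambda>f i. if i < n then f i else 0) ` ({..<n} \<rightarrow>\<^sub>E {..d})"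
  proof
    fix I assume I: "I \<in> multi_indices n d"
    have "I i \<le> d" if "i < n" for i
      using member_le_sum[of i "{..<n}" I] that I by (auto simp: multi_indices_def)
    with I have "I = (\<lambda>i. if i < n then restrict I {..<n} i else 0)" "restrict I {..<n} \<in> {..<n} \<rightarrow>\<^sub>E {..d}"
      by (auto simp: multi_indices_def fun_eq_iff)
    then show "I \<in> (\<lambda>f i. if i < n then f i else 0) ` ({..<n} \<rightarrow>\<^sub>E {..d})" by (rule image_eqI)
  qed
  then show ?thesis by (rule finite_subset) (intro finite_imageI finite_PiE; simp)
qed

definition top_form :: "nat \<Rightarrow> nat \<Rightarrow> ((nat \<Rightarrow> nat) \<Rightarrow> real) \<Rightarrow> (nat \<Rightarrow> real) \<Rightarrow> real" where
  "top_form n d \<alpha> v = (\<Sum>J\<in>{J \<in> multi_indices n d. sum J {..<n} = d}. \<alpha> J * (\<Prod>i<n. v i ^ J i))"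

text \<open>The mixed finite difference of order \<open>I\<close> at the origin maps the top form to \<open>\<alpha> I * (\<Prod>i. fact (I i))\<close>,
  since it kills every other monomial of degree \<open>d\<close>. Its weights have total mass \<open>2 ^ d\<close>, so the form is
  large at one of the nodes.\<close>
lemma top_form_lower_bound:
  assumes I: "I \<in> multi_indices n d" "sum I {..<n} = d"
  obtains v :: "nat \<Rightarrow> real" where "(\<Sum>i<n. \<bar>v i\<bar>) \<le> real d" "\<bar>\<alpha> I\<bar> \<le> 2 ^ d * \<bar>top_form n d \<alpha> v\<bar>"
proof -
  let ?T = "{J \<in> multi_indices n d. sum J {..<n} = d}"
  define N where "N = (\<Pi>\<^sub>E i\<in>{..<n}. {..I i})"
  \<comment> \<open>Weights of the difference of order \<open>I i\<close> in coordinate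
    \<open>i\<close>, with nodes \<open>0, ..., I i\<close>.\<close>
  define w where "w i m = (-1) ^ (I i - m) * real (I i choose m)" for i m
  have fN: "finite N" unfolding N_def by (intro finite_PiE) auto
  have fT: "finite ?T" using finite_multi_indices by simp
  have mono: "(\<Sum>m\<in>N. (\<Prod>i<n. w i (m i)) * (\<Prod>i<n. real (m i) ^ J i)) = (if J = I then (\<Prod>i<n. fact (I i)) else 0)"
    if J: "J \<in> ?T" for J
  proof -
    have "(\<Sum>m\<in>N. (\<Prod>i<n. w i (m i)) * (\<Prod>i<n. real (m i) ^ J i)) = (\<Prod>i<n. \<Sum>m\<le>I i. w i m * real m ^ J i)"
      unfolding N_def prod.distrib[symmetric] by (rule prod_sum_PiE[symmetric]) auto
    also have "\<dots> = (if J = I then (\<Prod>i<n. fact (I i)) else 0)"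
    proof (cases "J = I")
      case True
      then show ?thesis using alternating_binomial_power_sum by (simp add: w_def)
    next
      case False
      \<comment> \<open>Two different indices of equal total degree cannot satisfy
        \<open>I \<le> J\<close> coordinatewise, so some one-dimensional difference meets a power
        below its order and vanishes.\<close>
      have "\<exists>i<n. J i < I i"
      proof (rule ccontr)
        assume "\<not> ?thesis"
        then have le: "I i \<le> J i" if "i < n" for i using \<open>\<not> (\<exists>i<n. J i < I i)\<close> that not_less by blast
        have "\<forall>i\<in>{..<n}. I i = J i"
          using sum_mono_inv[of I "{..<n}" J] le I J by auto
        moreover have "I i = J i" if "\<not> i < n" for i using I J that by (simp add: multi_indices_def)
        ultimately have "J i = I i" for i by (cases "i < n") auto
        then show False using False by auto
      qed
      then obtain i where i: "i < n" "J i < I i" by auto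
      then have "(\<Sum>m\<le>I i. w i m * real m ^ J i) = 0"
        using alternating_binomial_power_sum[of "J i" "I i"] by (simp add: w_def)
      with i False show ?thesis by auto
    qed
    finally show ?thesis .
  qed
  have "(\<Sum>m\<in>N. (\<Prod>i<n. w i (m i)) * top_form n d \<alpha> (\<lambda>i. real (m i)))
     = (\<Sum>m\<in>N. \<Sum>J\<in>?T. \<alpha> J * ((\<Prod>i<n. w i (m i)) * (\<Prod>i<n. real (m i) ^ J i)))"
    unfolding top_form_def sum_distrib_left by (intro sum.cong refl) (simp add: mult_ac)
  also have "\<dots> = (\<Sum>J\<in>?T. \<alpha> J * (if J = I then (\<Prod>i<n. fact (I i)) else 0))"
    by (subst sum.swap) (simp add: sum_distrib_left[symmetric] mono)
  also have "\<dots> = \<alpha> I * (\<Prod>i<n. fact (I i))"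
    using I fT by (simp add: if_distrib[of "(*) _"] cong: if_cong)
  finally have eq: "(\<Sum>m\<in>N. (\<Prod>i<n. w i (m i)) * top_form n d \<alpha> (\<lambda>i. real (m i))) = \<alpha> I * (\<Prod>i<n. fact (I i))" .
  have ne: "N \<noteq> {}" by (auto simp: N_def PiE_eq_empty_iff)
  define L where "L = Max ((\<lambda>m. \<bar>top_form n d \<alpha> (\<lambda>i. real (m i))\<bar>) ` N)"
  have "L \<in> (\<lambda>m. \<bar>top_form n d \<alpha> (\<lambda>i. real (m i))\<bar>) ` N"
    unfolding L_def using fN ne by (intro Max_in) auto
  then obtain m where m: "m \<in> N" "L = \<bar>top_form n d \<alpha> (\<lambda>i. real (m i))\<bar>" by auto
  \<comment> \<open>Nodes lie coordinatewise below \<open>I\<close>, which gives the bound on the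
    l1-norm.\<close>
  have "(\<Sum>i<n. real (m i)) \<le> (\<Sum>i<n. real (I i))"
    using m(1) by (intro sum_mono) (auto simp: N_def PiE_def Pi_def)
  also have "\<dots> = real d" using I by (simp flip: of_nat_sum)
  finally have small: "(\<Sum>i<n. \<bar>real (m i)\<bar>) \<le> real d" by simp
  have "(1::real) \<le> (\<Prod>i<n. fact (I i))" by (intro prod_ge_1) auto
  then have "\<bar>\<alpha> I\<bar> \<le> \<bar>\<alpha> I * (\<Prod>i<n. fact (I i))\<bar>"
    using mult_left_mono[of 1 "\<Prod>i<n. fact (I i)" "\<bar>\<alpha> I\<bar>"] by (simp add: abs_mult)
  also have "\<dots> \<le> (\<Sum>m\<in>N. \<bar>(\<Prod>i<n. w i (m i)) * top_form n d \<alpha> (\<lambda>i. real (m i))\<bar>)"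
    unfolding eq[symmetric] by (rule sum_abs)
  also have "\<dots> \<le> (\<Sum>m\<in>N. (\<Prod>i<n. real (I i choose m i)) * L)"
  proof (rule sum_mono)
    fix m assume "m \<in> N"
    then have "\<bar>top_form n d \<alpha> (\<lambda>i. real (m i))\<bar> \<le> L" unfolding L_def using fN by (intro Max_ge) auto
    moreover have "\<bar>\<Prod>i<n. w i (m i)\<bar> = (\<Prod>i<n. real (I i choose m i))"
      by (simp add: abs_prod w_def abs_mult power_abs)
    ultimately show "\<bar>(\<Prod>i<n. w i (m i)) * top_form n d \<alpha> (\<lambda>i. real (m i))\<bar> \<le> (\<Prod>i<n. real (I i choose m i)) * L"
      by (simp add: abs_mult mult_left_mono prod_nonneg)
  qed
  also have "\<dots> = (\<Prod>i<n. \<Sum>m\<le>I i. real (I i choose m)) * L"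
    unfolding N_def sum_distrib_right[symmetric] by (subst prod_sum_PiE) auto
  also have "(\<Prod>i<n. \<Sum>m\<le>I i. real (I i choose m)) = (\<Prod>i<n. 2 ^ I i)"
    by (intro prod.cong refl) (metis choose_row_sum of_nat_numeral of_nat_power of_nat_sum)
  also have "\<dots> = 2 ^ d" using I by (simp add: power_sum[symmetric])
  finally show thesis using small m(2) by (intro that[of "\<lambda>i. real (m i)"]) auto
qed

section \<open>Restriction of a polynomial to a line\<close>

definition line_poly :: "nat \<Rightarrow> nat \<Rightarrow> ((nat \<Rightarrow> nat) \<Rightarrow> real) \<Rightarrow> (nat \<Rightarrow> real) \<Rightarrow> (nat \<Rightarrow> real) \<Rightarrow> real poly" where
  "line_poly n d \<alpha> v x = (\<Sum>J\<in>multi_indices n d. smult (\<alpha> J) (\<Prod>i<n. [:x i, v i:] ^ J i))"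

lemma poly_line_poly: "poly (line_poly n d \<alpha> v x) s = poly_eval n d \<alpha> (\<lambda>i. x i + s * v i)"
  by (simp add: line_poly_def poly_eval_def poly_sum poly_prod)

text \<open>Degree bounds take the place of exact degrees because a factor
  \<open>[:x i, v i:]\<close> degenerates to a constant when \<open>v i = 0\<close>.\<close>

lemma coeff_mult_top:
  fixes p q :: "'a::comm_semiring_0 poly"
  assumes "degree p \<le> a" "degree q \<le> b"
  shows "coeff (p * q) (a + b) = coeff p a * coeff q b"
proof -
  have "coeff p i * coeff q (a + b - i) = 0" if "i \<le> a + b" "i \<noteq> a" for i
  proof (cases "i < a")
    case True
    with assms have "coeff q (a + b - i) = 0" by (intro coeff_eq_0) auto
    then show ?thesis by simp
  next
    case False
    with that assms have "coeff p i = 0" by (intro coeff_eq_0) auto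
    then show ?thesis by simp
  qed
  then have "(\<Sum>i\<le>a + b. coeff p i * coeff q (a + b - i)) = (\<Sum>i\<in>{a}. coeff p i * coeff q (a + b - i))"
    by (intro sum.mono_neutral_right) auto
  then show ?thesis by (simp add: coeff_mult)
qed

lemma linear_power_top:
  fixes a b :: "'a::comm_ring_1"
  shows "degree ([:a, b:] ^ k) \<le> k \<and> coeff ([:a, b:] ^ k) k = b ^ k"
proof (induction k)
  case (Suc k)
  have d: "degree [:a, b:] \<le> 1" by simp
  have "degree ([:a, b:] * [:a, b:] ^ k) \<le> 1 + k"
    using degree_mult_le[of "[:a, b:]" "[:a, b:] ^ k"] Suc d by linarith
  moreover have "coeff ([:a, b:] * [:a, b:] ^ k) (1 + k) = b * b ^ k"
    using coeff_mult_top[OF d, of "[:a, b:] ^ k" k] Suc by simp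
  ultimately show ?case by simp
qed simp

lemma linear_monomial_top:
  fixes x v :: "nat \<Rightarrow> real"
  assumes "finite A"
  shows "degree (\<Prod>i\<in>A. [:x i, v i:] ^ J i) \<le> sum J A \<and> coeff (\<Prod>i\<in>A. [:x i, v i:] ^ J i) (sum J A) = (\<Prod>i\<in>A. v i ^ J i)"
  using assms
proof (induction A rule: finite_induct)
  case (insert k A)
  let ?p = "[:x k, v k:] ^ J k" and ?q = "\<Prod>i\<in>A. [:x i, v i:] ^ J i"
  have "degree (?p * ?q) \<le> J k + sum J A"
    using degree_mult_le[of ?p ?q] linear_power_top[of "x k" "v k" "J k"] insert by linarith
  moreover have "coeff (?p * ?q) (J k + sum J A) = v k ^ J k * (\<Prod>i\<in>A. v i ^ J i)"
    using coeff_mult_top[of ?p "J k" ?q "sum J A"] linear_power_top[of "x k" "v k" "J k"] insert by simp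
  ultimately show ?case using insert by simp
qed simp

lemma degree_line_poly_le: "degree (line_poly n d \<alpha> v x) \<le> d"
  unfolding line_poly_def
proof (rule degree_sum_le)
  fix J assume J: "J \<in> multi_indices n d"
  have "degree (smult (\<alpha> J) (\<Prod>i<n. [:x i, v i:] ^ J i)) \<le> degree (\<Prod>i<n. [:x i, v i:] ^ J i)"
    by (rule degree_smult_le)
  also have "\<dots> \<le> d" using linear_monomial_top[of "{..<n}" x v J] J by (simp add: multi_indices_def)
  finally show "degree (smult (\<alpha> J) (\<Prod>i<n. [:x i, v i:] ^ J i)) \<le> d" .
qed (rule finite_multi_indices)

text \<open>Monomials of lower total degree do not reach degree \<open>d\<close>. The value does not
  involve \<open>x\<close>, which makes the one-dimensional bound uniform over all parallel
  lines.\<close>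

lemma coeff_line_poly: "coeff (line_poly n d \<alpha> v x) d = top_form n d \<alpha> v"
proof -
  have "coeff (line_poly n d \<alpha> v x) d = (\<Sum>J\<in>multi_indices n d. \<alpha> J * coeff (\<Prod>i<n. [:x i, v i:] ^ J i) d)"
    by (simp add: line_poly_def coeff_sum)
  also have "\<dots> = (\<Sum>J\<in>multi_indices n d. if sum J {..<n} = d then \<alpha> J * (\<Prod>i<n. v i ^ J i) else 0)"
  proof (intro sum.cong refl)
    fix J assume J: "J \<in> multi_indices n d"
    show "\<alpha> J * coeff (\<Prod>i<n. [:x i, v i:] ^ J i) d = (if sum J {..<n} = d then \<alpha> J * (\<Prod>i<n. v i ^ J i) else 0)"
    proof (cases "sum J {..<n} = d")
      case False
      with J have "sum J {..<n} < d" by (simp add: multi_indices_def)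
      then have "coeff (\<Prod>i<n. [:x i, v i:] ^ J i) d = 0"
        using linear_monomial_top[of "{..<n}" x v J] by (intro coeff_eq_0) auto
      with False show ?thesis by simp
    qed (use linear_monomial_top[of "{..<n}" x v J] in auto)
  qed
  also have "\<dots> = top_form n d \<alpha> v"
    unfolding top_form_def by (rule sum.inter_filter[OF finite_multi_indices, symmetric])
  finally show ?thesis .
qed

subsection \<open>The main estimate\<close>

lemma poly_eval_cong: "(\<And>i. i < n \<Longrightarrow> x i = y i) \<Longrightarrow> poly_eval n d \<alpha> x = poly_eval n d \<alpha> y"
  by (simp add: poly_eval_def)

lemma has_vector_derivative_quotient:
  assumes "(f has_vector_derivative D) (at x)"
  shows "((\<lambda>y. (f (x + y) - f x) /\<^sub>R y) \<longlongrightarrow> D) (at 0)"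
proof -
  have "((\<lambda>y. norm (f (x + y) - f x - y *\<^sub>R D) / norm y) \<longlongrightarrow> 0) (at 0)"
    using assms unfolding has_vector_derivative_def has_derivative_at by simp
  moreover have "eventually (\<lambda>y. norm (f (x + y) - f x - y *\<^sub>R D) / norm y = norm ((f (x + y) - f x) /\<^sub>R y - D)) (at 0)"
  proof (rule eventually_at_filter[THEN iffD2], intro always_eventually allI impI)
    fix y :: real assume y: "y \<noteq> 0"
    then have "(f (x + y) - f x) /\<^sub>R y - D = (f (x + y) - f x - y *\<^sub>R D) /\<^sub>R y"
      by (simp add: scaleR_diff_right)
    then show "norm (f (x + y) - f x - y *\<^sub>R D) / norm y = norm ((f (x + y) - f x) /\<^sub>R y - D)"
      by (simp add: divide_inverse mult.commute)
  qed
  ultimately have "((\<lambda>y. norm ((f (x + y) - f x) /\<^sub>R y - D)) \<longlongrightarrow> 0) (at 0)"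
    by (rule Lim_transform_eventually)
  then show ?thesis by (simp add: Lim_null[of _ D] tendsto_norm_zero_iff)
qed

text \<open>\<open>H\<close> is the primitive of \<open>h\<close> along the lines in direction \<open>v\<close> which vanishes on the hyperplane
  \<open>x j = 0\<close>. It is bounded by the one-dimensional estimate, and \<open>h\<close> is the limit of its difference
  quotients in direction \<open>v\<close>, whose integrals are controlled by the shift estimate for the product measure.\<close>
lemma directional_oscillatory_bound:
  assumes prob: "prob_space \<nu>" and sets: "sets \<nu> = sets borel"
    and shift: "\<And>\<phi> s B. \<phi> \<in> borel_measurable borel \<Longrightarrow> (\<And>x. norm (\<phi> x :: complex) \<le> B) \<Longrightarrow>
       norm ((\<integral>x. \<phi> (x + s) \<partial>\<nu>) - (\<integral>x. \<phi> x \<partial>\<nu>)) \<le> K * \<bar>s\<bar> * B"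
    and d: "d \<ge> 1" and t: "t \<noteq> 0" and c: "top_form n d \<alpha> v \<noteq> 0" and j: "j < n" "v j \<noteq> 0"
  shows "norm (\<integral>x. cis (t * poly_eval n d \<alpha> x) \<partial>PiM {..<n} (\<lambda>_. \<nu>))
     \<le> K * (\<Sum>i<n. \<bar>v i\<bar>) * (34 / \<bar>t * top_form n d \<alpha> v\<bar> powr (1 / real d))"
proof -
  let ?P = "PiM {..<n} (\<lambda>_. \<nu>)"
  interpret P: prob_space ?P by (intro prob_space_PiM prob)
  note [measurable_cong] = sets
  define h where "h x = cis (t * poly_eval n d \<alpha> x)" for x
  define B where "B = 34 / \<bar>t * top_form n d \<alpha> v\<bar> powr (1 / real d)"
  \<comment> \<open>\<open>R x\<close> is the position of \<open>x\<close> on its line, measured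
    from the point \<open>base x\<close> where the line meets the hyperplane
    \<open>x j = 0\<close>.\<close>
  define R where "R x = x j / v j" for x :: "nat \<Rightarrow> real"
  define base where "base x i = x i - R x * v i" for x i
  define p where "p x = smult t (line_poly n d \<alpha> v (base x))" for x
  \<comment> \<open>An explicit integral over \<open>{0..1}\<close>, so that measurability in
    \<open>x\<close> follows from that of parameter integrals. The antiderivatives \<open>F\<close>
    are chosen separately for each polynomial and give no such control.\<close>
  define H where "H x = of_real (R x) * (\<integral>u. indicator {0..1} u *\<^sub>R cis (poly (p x) (u * R x)) \<partial>lborel)" for x
  have p_eval: "poly (p x) s = t * poly_eval n d \<alpha> (\<lambda>i. x i + (s - R x) * v i)" for x s
    by (simp add: p_def poly_line_poly base_def algebra_simps)
  have coeff_p: "coeff (p x) d = t * top_form n d \<alpha> v" for x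
    by (simp add: p_def coeff_line_poly)
  have deg: "degree (p x) = d" for x
  proof (rule antisym)
    show "degree (p x) \<le> d"
      unfolding p_def using degree_smult_le degree_line_poly_le by (rule order_trans)
    show "d \<le> degree (p x)" using coeff_p[of x] t c by (intro le_degree) auto
  qed
  have ex: "\<exists>F. \<forall>r. (F has_vector_derivative cis (poly q r)) (at r)" for q
  proof -
    have "isCont (\<lambda>r. cis (poly q r)) r" for r
      by (rule has_vector_derivative_continuous[OF cis_poly_has_vector_derivative])
    then show ?thesis using einterval_antiderivative[of "-\<infinity>" \<infinity> "\<lambda>r. cis (poly q r)"] by auto
  qed
  define F where "F q = (SOME F. \<forall>r. (F has_vector_derivative cis (poly q r)) (at r))" for q
  have F: "(F q has_vector_derivative cis (poly q r)) (at r)" for q r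
    using someI_ex[OF ex[of q]] by (simp add: F_def)
  have H_F: "H x = F (p x) (R x) - F (p x) 0" for x
  proof -
    let ?f = "\<lambda>u. R x *\<^sub>R cis (poly (p x) (u * R x))"
    have "((\<lambda>u. F (p x) (u * R x)) has_vector_derivative ?f u) (at u within {0..1})" for u
    proof (rule has_vector_derivative_at_within)
      have "((\<lambda>u. u * R x) has_vector_derivative R x) (at u)"
        by (simp add: has_real_derivative_iff_has_vector_derivative[symmetric]) (auto intro!: derivative_eq_intros)
      from vector_diff_chain_at[OF this F] show "((\<lambda>u. F (p x) (u * R x)) has_vector_derivative ?f u) (at u)"
        by (simp add: o_def)
    qed
    then have "(\<integral>u. indicator {0..1} u *\<^sub>R ?f u \<partial>lborel) = F (p x) (1 * R x) - F (p x) (0 * R x)"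
      by (intro integral_FTC_Icc) (auto intro!: continuous_intros)
    then show ?thesis by (simp add: H_def scaleR_conv_of_real mult_ac)
  qed
  have H_bound: "norm (H x) \<le> B" for x
    unfolding H_F B_def by (rule order_trans[OF polynomial_oscillatory_bound[OF F deg d]]) (simp add: deg coeff_p)
  have eval_meas: "(\<lambda>y. poly_eval n d \<alpha> (X y)) \<in> borel_measurable M"
    if "\<And>i. i < n \<Longrightarrow> (\<lambda>y. X y i) \<in> borel_measurable M" for M :: "'z measure" and X
    unfolding poly_eval_def using that by (intro borel_measurable_sum borel_measurable_times borel_measurable_prod borel_measurable_power) auto
  have comp[measurable]: "(\<lambda>x. x i) \<in> borel_measurable ?P" if "i < n" for i
    using measurable_component_singleton[of i "{..<n}" "\<lambda>_. \<nu>"] that by (simp add: measurable_cong_sets[OF refl sets])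
  have R_meas[measurable]: "R \<in> borel_measurable ?P" unfolding R_def using comp[OF j(1)] by measurable
  have cis_meas: "cis \<in> borel_measurable borel"
    by (intro borel_measurable_continuous_onI continuous_intros)
  have h_meas: "h \<in> borel_measurable ?P"
    unfolding h_def using eval_meas[of "\<lambda>x. x" ?P] comp by (intro measurable_compose[OF _ cis_meas]) auto
  have H_meas: "H \<in> borel_measurable ?P"
  proof -
    have "(\<lambda>y. poly_eval n d \<alpha> (\<lambda>i. fst y i + (snd y * R (fst y) - R (fst y)) * v i)) \<in> borel_measurable (?P \<Otimes>\<^sub>M lborel)"
    proof (rule eval_meas)
      fix i assume "i < n"
      then have [measurable]: "(\<lambda>y. fst y i) \<in> borel_measurable (?P \<Otimes>\<^sub>M lborel)"
        using measurable_compose[OF measurable_fst comp] by simp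
      show "(\<lambda>y. fst y i + (snd y * R (fst y) - R (fst y)) * v i) \<in> borel_measurable (?P \<Otimes>\<^sub>M lborel)"
        by measurable
    qed
    then have "(\<lambda>(x, u). indicator {0..1::real} u *\<^sub>R cis (poly (p x) (u * R x))) \<in> borel_measurable (?P \<Otimes>\<^sub>M lborel)"
      unfolding case_prod_beta' p_eval
      by (intro borel_measurable_scaleR measurable_compose[OF _ cis_meas] borel_measurable_times) auto
    then have "(\<lambda>x. \<integral>u. indicator {0..1::real} u *\<^sub>R cis (poly (p x) (u * R x)) \<partial>lborel) \<in> borel_measurable ?P"
      by (rule lborel.borel_measurable_lebesgue_integral)
    then show ?thesis unfolding H_def by measurable
  qed
  define sh where "sh s x = (\<lambda>i\<in>{..<n}. x i + s * v i)" for s and x :: "nat \<Rightarrow> real"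
  have sh_meas: "sh s \<in> measurable ?P ?P" for s
    unfolding sh_def
  proof (rule measurable_restrict)
    show "(\<lambda>x. x i + s * v i) \<in> measurable ?P \<nu>" if "i \<in> {..<n}" for i
      unfolding measurable_cong_sets[OF refl sets] using comp[of i] that by (intro borel_measurable_add borel_measurable_const) auto
  qed
  \<comment> \<open>A shift along \<open>v\<close> stays on the same line: the position advances by
    \<open>s\<close>, while the polynomial \<open>p x\<close> is unchanged.\<close>
  have R_sh: "R (sh s x) = R x + s" for s x using j by (simp add: R_def sh_def field_simps)
  have p_sh: "p (sh s x) = p x" for s x
  proof -
    have "poly (p (sh s x)) r = poly (p x) r" for r
      unfolding p_eval R_sh by (auto intro!: poly_eval_cong simp: sh_def algebra_simps)
    then show ?thesis by (intro poly_eqI_degree poly_ext) (auto simp: fun_eq_iff poly_eq_poly_eq_iff[symmetric])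
  qed
  have H_diff: "H (sh s x) - H x = F (p x) (R x + s) - F (p x) (R x)" for s x
    by (simp add: H_F p_sh R_sh)
  define s where "s N = inverse (real (Suc N))" for N
  have s: "s N > 0" for N by (simp add: s_def)
  define Q where "Q N x = (H (sh (s N) x) - H x) /\<^sub>R s N" for N x
  have lim: "(\<lambda>N. Q N x) \<longlonglongrightarrow> h x" for x
  proof -
    have hx: "cis (poly (p x) (R x)) = h x" by (simp add: p_eval h_def)
    have "((\<lambda>y. (F (p x) (R x + y) - F (p x) (R x)) /\<^sub>R y) \<longlongrightarrow> cis (poly (p x) (R x))) (at 0)"
      by (rule has_vector_derivative_quotient[OF F])
    moreover have "filterlim s (at 0) sequentially"
    proof -
      have "s \<longlonglongrightarrow> 0" unfolding s_def[abs_def] by (rule LIMSEQ_inverse_real_of_nat)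
      moreover have "s N \<noteq> 0" for N using s[of N] by simp
      ultimately show ?thesis unfolding filterlim_at by simp
    qed
    ultimately have "(\<lambda>N. (F (p x) (R x + s N) - F (p x) (R x)) /\<^sub>R s N) \<longlonglongrightarrow> cis (poly (p x) (R x))"
      by (rule filterlim_compose)
    then show ?thesis by (simp add: Q_def H_diff hx)
  qed
  have Q_meas: "Q N \<in> borel_measurable ?P" for N
    unfolding Q_def using H_meas measurable_compose[OF sh_meas H_meas] by measurable
  \<comment> \<open>The integrand has modulus \<open>1\<close>, so the difference quotients are
    dominated by the constant \<open>1\<close>.\<close>
  have "norm (Q N x) \<le> 1" for N x
  proof -
    have le: "norm (F (p x) (R x + s N) - F (p x) (R x)) \<le> R x + s N - R x"
      by (rule norm_primitive_diff_le[OF F]) (use s[of N] in auto)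
    have "norm (Q N x) = norm (F (p x) (R x + s N) - F (p x) (R x)) / s N"
      using s[of N] by (simp add: Q_def H_diff divide_inverse mult.commute)
    then show ?thesis using s[of N] le by simp
  qed
  then have conv: "(\<lambda>N. \<integral>x. Q N x \<partial>?P) \<longlonglongrightarrow> (\<integral>x. h x \<partial>?P)"
    by (intro integral_dominated_convergence[where w = "\<lambda>_. 1"] Q_meas h_meas AE_I2 lim P.integrable_const)
  have intH: "integrable ?P H"
    using H_meas H_bound by (intro P.integrable_const_bound[of _ B]) auto
  have intHs: "integrable ?P (\<lambda>x. H (sh r x))" for r
    using measurable_compose[OF sh_meas H_meas] H_bound by (intro P.integrable_const_bound[of _ B]) auto
  have "norm (\<integral>x. Q N x \<partial>?P) \<le> K * (\<Sum>i<n. \<bar>v i\<bar>) * B" for N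
  proof -
    \<comment> \<open>The shift estimate is linear in the step \<open>s N\<close>, which therefore
      cancels in the difference quotient.\<close>
    have "norm ((\<integral>x. H (sh (s N) x) \<partial>?P) - (\<integral>x. H x \<partial>?P)) \<le> K * (\<Sum>i<n. \<bar>s N * v i\<bar>) * B"
      unfolding sh_def by (rule PiM_shift[OF prob sets shift _ H_meas H_bound]) auto
    also have "\<dots> = s N * (K * (\<Sum>i<n. \<bar>v i\<bar>) * B)"
      using s[of N] by (simp add: abs_mult sum_distrib_left[symmetric])
    also have "(\<integral>x. H (sh (s N) x) \<partial>?P) - (\<integral>x. H x \<partial>?P) = s N *\<^sub>R (\<integral>x. Q N x \<partial>?P)"
      using s[of N] intH intHs by (simp add: Q_def)
    finally show ?thesis using s[of N] by simp
  qed
  then have "norm (\<integral>x. h x \<partial>?P) \<le> K * (\<Sum>i<n. \<bar>v i\<bar>) * B"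
    using tendsto_norm[OF conv] by (intro tendsto_upperbound[of _ _ sequentially]) auto
  then show ?thesis by (simp add: h_def B_def)
qed

text \<open>That the degree is exactly \<open>d\<close> is expressed by a nonzero coefficient of
  total degree \<open>d\<close>; this makes \<open>top_coeff_max\<close> positive.\<close>

theorem theorem2p6:
  "\<exists>C::real. C > 0 \<and>
    (\<forall>(\<nu>::real measure) (n::nat) (d::nat) (\<alpha>::(nat \<Rightarrow> nat) \<Rightarrow> real) (t::real).
       log_concave_measure \<nu> \<and> isotropic \<nu> \<and> 1 \<le> d \<and>
       (\<exists>I\<in>multi_indices n d. sum I {..<n} = d \<and> \<alpha> I \<noteq> 0) \<and> t \<noteq> 0 \<longrightarrow>
       cmod (\<integral>x. cis (t * poly_eval n d \<alpha> x) \<partial>(PiM {..<n} (\<lambda>_. \<nu>)))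
         \<le> C * real d / (top_coeff_max n d \<alpha> * \<bar>t\<bar>) powr (1 / real d))"
\<comment> \<open>\<open>4080 = 60 * 34 * 2\<close>: the translation cost, the oscillatory bound,
  and the \<open>d\<close>-th root of the loss \<open>2 ^ d\<close> in the choice of
  direction.\<close>
proof (intro exI[of _ 4080] conjI allI impI)
  fix \<nu> :: "real measure" and n d :: nat and \<alpha> :: "(nat \<Rightarrow> nat) \<Rightarrow> real" and t :: real
  assume "log_concave_measure \<nu> \<and> isotropic \<nu> \<and> 1 \<le> d \<and>
       (\<exists>I\<in>multi_indices n d. sum I {..<n} = d \<and> \<alpha> I \<noteq> 0) \<and> t \<noteq> 0"
  then obtain I0 where \<nu>: "log_concave_measure \<nu>" "isotropic \<nu>" and d: "1 \<le> d" and t: "t \<noteq> 0"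
    and I0: "I0 \<in> multi_indices n d" "sum I0 {..<n} = d" "\<alpha> I0 \<noteq> 0" by blast
  have prob: "prob_space \<nu>" and sets: "sets \<nu> = sets borel"
    using \<nu>(1) by (auto simp: log_concave_measure_def)
  define M where "M = top_coeff_max n d \<alpha>"
  let ?A = "{\<bar>\<alpha> I\<bar> | I. I \<in> multi_indices n d \<and> sum I {..<n} = d}"
  have "?A \<subseteq> (\<lambda>I. \<bar>\<alpha> I\<bar>) ` multi_indices n d" by auto
  then have fA: "finite ?A" by (rule finite_subset) (simp add: finite_multi_indices)
  have A0: "\<bar>\<alpha> I0\<bar> \<in> ?A" using I0 by auto
  have "M \<in> ?A" unfolding M_def top_coeff_max_def using fA A0 by (intro Max_in) auto
  then obtain I where I: "I \<in> multi_indices n d" "sum I {..<n} = d" "M = \<bar>\<alpha> I\<bar>" by auto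
  have "\<bar>\<alpha> I0\<bar> \<le> M" unfolding M_def top_coeff_max_def using fA A0 by (rule Max_ge)
  with I0 have M: "M > 0" by linarith
  obtain v where v: "(\<Sum>i<n. \<bar>v i\<bar>) \<le> real d" "\<bar>\<alpha> I\<bar> \<le> 2 ^ d * \<bar>top_form n d \<alpha> v\<bar>"
    by (rule top_form_lower_bound[OF I(1,2)])
  define c where "c = \<bar>top_form n d \<alpha> v\<bar>"
  have cM: "M \<le> 2 ^ d * c" using v I by (simp add: c_def)
  with M have c: "c > 0" by (smt (verit) zero_less_mult_pos zero_less_power c_def)
  \<comment> \<open>A form of degree at least \<open>1\<close> vanishes at the origin, so the
    direction is nonzero and some coordinate can parametrize the lines.\<close>
  have "\<exists>j<n. v j \<noteq> 0"
  proof (rule ccontr)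
    assume "\<not> ?thesis"
    then have v0: "v i = 0" if "i < n" for i using that by blast
    have "(\<Prod>i<n. v i ^ J i) = 0" if J: "sum J {..<n} = d" for J
    proof -
      obtain i where "i < n" "J i \<noteq> 0" using J d by (metis lessThan_iff not_one_le_zero sum.neutral)
      then show ?thesis using v0 by (auto intro!: bexI[of _ i])
    qed
    then have "top_form n d \<alpha> v = 0"
      unfolding top_form_def by (intro sum.neutral ballI) (simp only: mem_Collect_eq mult_zero_right)
    with c show False by (simp add: c_def)
  qed
  then obtain j where j: "j < n" "v j \<noteq> 0" by blast
  have "cmod (\<integral>x. cis (t * poly_eval n d \<alpha> x) \<partial>(PiM {..<n} (\<lambda>_. \<nu>)))
      \<le> 60 * (\<Sum>i<n. \<bar>v i\<bar>) * (34 / \<bar>t * top_form n d \<alpha> v\<bar> powr (1 / real d))"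
    using c by (intro directional_oscillatory_bound[where j = j] prob sets isotropic_log_concave_translation[OF \<nu>] d t j) (auto simp: c_def)
  also have "\<dots> \<le> 60 * real d * (34 / ((M * \<bar>t\<bar>) powr (1 / real d) / 2))"
  proof -
    have "(M * \<bar>t\<bar>) powr (1 / real d) \<le> (2 ^ d * \<bar>t * top_form n d \<alpha> v\<bar>) powr (1 / real d)"
    proof (rule powr_mono2)
      show "M * \<bar>t\<bar> \<le> 2 ^ d * \<bar>t * top_form n d \<alpha> v\<bar>"
        using mult_right_mono[OF cM, of "\<bar>t\<bar>"] by (simp add: c_def abs_mult mult_ac)
    qed (use M in auto)
    also have "\<dots> = 2 * \<bar>t * top_form n d \<alpha> v\<bar> powr (1 / real d)"
    proof -
      have "((2::real) ^ d) powr (1 / real d) = 2"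
        using d by (simp add: powr_powr flip: powr_realpow)
      then show ?thesis by (simp add: powr_mult)
    qed
    finally have half: "(M * \<bar>t\<bar>) powr (1 / real d) / 2 \<le> \<bar>t * top_form n d \<alpha> v\<bar> powr (1 / real d)" by simp
    have pos: "0 < (M * \<bar>t\<bar>) powr (1 / real d) / 2" using M t by simp
    have "34 / \<bar>t * top_form n d \<alpha> v\<bar> powr (1 / real d) \<le> 34 / ((M * \<bar>t\<bar>) powr (1 / real d) / 2)"
      by (rule frac_le[OF _ _ pos half]) simp_all
    then show ?thesis using v(1) by (intro mult_mono) auto
  qed
  also have "\<dots> = 4080 * real d / (M * \<bar>t\<bar>) powr (1 / real d)" by simp
  finally show "cmod (\<integral>x. cis (t * poly_eval n d \<alpha> x) \<partial>(PiM {..<n} (\<lambda>_. \<nu>)))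
         \<le> 4080 * real d / (top_coeff_max n d \<alpha> * \<bar>t\<bar>) powr (1 / real d)" by (simp add: M_def)
qed simp

end
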